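(* Let $\mathcal{M}$ be a factor acting on a separable complex Hilbert space, and let $\mathcal{A}\subseteq\mathcal{M}$ be a norm closed unital subalgebra that is $\mathcal{M}$-reflexive and logmodular in $\mathcal{M}$. Then $\mathcal{A}$ is a nest subalgebra of $\mathcal{M}$. In particular, for a separable complex Hilbert space $\mathcal{H}$, every reflexive logmodular algebra in $\mathcal{B}(\mathcal{H})$ (hence every logmodular algebra in $\mathcal{B}(\mathcal{H})$ that is a completely distributive CSL algebra) is a nest algebra.
   Context: Subalgebras are not assumed self-adjoint; they contain the identity $1$. Projections are orthogonal projections. $\mathcal{A}^{-1}=\{a\in\mathcal{A}: a \text{ is invertible and } a^{-1}\in\mathcal{A}\}$, and $\mathcal{M}_+^{-1}$ is the set of positive invertible elements of $\mathcal{M}$. $\mathcal{A}$ is logmodular in $\mathcal{M}$ if $\{a^*a: a\in\mathcal{A}^{-1}\}$ is norm dense in $\mathcal{M}_+^{-1}$. $\mathrm{Lat}_{\mathcal{M}}\mathcal{A}=\{p\in\mathcal{M}: p=p^2=p^*,\ ap=pap\ \forall a\in\mathcal{A}\}$. For a collection $\mathcal{E}$ of projections in $\mathcal{M}$, $\mathrm{Alg}_{\mathcal{M}}\mathcal{E}=\{x\in\mathcal{M}: xp=pxp\ \forall p\in\mathcal{E}\}$. When $\mathcal{M}=\mathcal{B}(\mathcal{H})$ the subscript is dropped. $\mathcal{A}$ is $\mathcal{M}$-reflexive (reflexive if $\mathcal{M}=\mathcal{B}(\mathcal{H})$) if $\mathcal{A}=\mathrm{Alg}_{\mathcal{M}}\mathrm{Lat}_{\mathcal{M}}\mathcal{A}$.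 A nest in $\mathcal{M}$ is a lattice of projections in $\mathcal{M}$ totally ordered by the operator order. $\mathcal{A}$ is a nest subalgebra of $\mathcal{M}$ (nest algebra if $\mathcal{M}=\mathcal{B}(\mathcal{H})$) if $\mathcal{A}=\mathrm{Alg}_{\mathcal{M}}\mathcal{E}$ for some nest $\mathcal{E}$ in $\mathcal{M}$. A commutative subspace lattice (CSL) is a lattice of pairwise commuting projections; a (completely distributive) CSL algebra is an algebra $\mathrm{Alg}\,\mathcal{E}$ with $\mathcal{E}$ a (completely distributive) CSL, complete distributivity being the usual lattice-theoretic notion (arbitrary meets and joins distribute over each other). A factor is a von Neumann algebra with trivial center. *)

theory Defs
  imports "HOL-Algebra.Complete_Lattice" "HOL-Analysis.Analysis"
begin

section \<open>Complex Hilbert spaces\<close>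

text \<open>
  The library has only real inner product spaces.  A complex Hilbert space is a complete real inner
  product space with a compatible complex scalar multiplication and a sesquilinear product (conjugate
  linear in the first argument) whose real part is the given real inner product.  Positive
  definiteness, and that the norm is the one induced by \<open>cinner\<close>, are inherited from
  \<^class>\<open>real_inner\<close>, as \<open>cinner x x\<close> is real by conjugate symmetry.
\<close>

class complex_hilbert_space = real_inner + complete_space +
  fixes scaleC :: "complex \<Rightarrow> 'a \<Rightarrow> 'a"  (infixr \<open>*\<^sub>C\<close> 75)
    and cinner :: "'a \<Rightarrow> 'a \<Rightarrow> complex"
  assumes scaleC_add_right: "c *\<^sub>C (x + y) = c *\<^sub>C x + c *\<^sub>C y"
    and scaleC_add_left: "(c + d) *\<^sub>C x = c *\<^sub>C x + d *\<^sub>C x"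
    and scaleC_scaleC: "c *\<^sub>C (d *\<^sub>C x) = (c * d) *\<^sub>C x"
    and scaleR_scaleC: "r *\<^sub>R x = complex_of_real r *\<^sub>C x"
    and cinner_commute: "cinner x y = cnj (cinner y x)"
    and cinner_add_left: "cinner (x + y) z = cinner x z + cinner y z"
    and cinner_scaleC_left: "cinner (c *\<^sub>C x) y = cnj c * cinner x y"
    and inner_eq_Re_cinner: "inner x y = Re (cinner x y)"

lemma norm_scaleC: "norm (c *\<^sub>C x) = cmod c * norm (x :: 'a::complex_hilbert_space)"
proof -
  have *: "cinner (c *\<^sub>C x) (c *\<^sub>C x) = cnj c * c * cinner x x"
    using cinner_commute[of x "c *\<^sub>C x"]
    by (simp add: cinner_scaleC_left cinner_commute[of x x, symmetric])
  have "cnj c * c = complex_of_real ((cmod c)\<^sup>2)"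
    by (metis complex_norm_square mult.commute)
  then have "inner (c *\<^sub>C x) (c *\<^sub>C x) = (cmod c)\<^sup>2 * inner x x"
    by (simp add: inner_eq_Re_cinner * del: of_real_power)
  then show ?thesis
    by (simp add: norm_eq_sqrt_inner real_sqrt_mult)
qed


section \<open>Bounded operators\<close>

text \<open>
  Operators live in the real Banach space \<^typ>\<open>'a \<Rightarrow>\<^sub>L 'a\<close> of bounded real-linear maps;
  the algebra of all bounded complex-linear operators is the following subset.  The norm of
  \<^typ>\<open>'a \<Rightarrow>\<^sub>L 'a\<close> is the operator norm, so \<^const>\<open>closed\<close> and \<^const>\<open>closure\<close> refer
  to the norm topology.
\<close>

definition bounded_ops :: "('a::complex_hilbert_space \<Rightarrow>\<^sub>L 'a) set" where
  "bounded_ops = {T. \<forall>c x. blinfun_apply T (c *\<^sub>C x) = c *\<^sub>C blinfun_apply T x}"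

lift_definition scalar_op :: "complex \<Rightarrow> 'a::complex_hilbert_space \<Rightarrow>\<^sub>L 'a" is "\<lambda>c x. c *\<^sub>C x"
proof (rule bounded_linear_intro)
  fix c d :: complex and x y :: 'a and r :: real
  show "c *\<^sub>C (x + y) = c *\<^sub>C x + c *\<^sub>C y" by (rule scaleC_add_right)
  show "c *\<^sub>C (r *\<^sub>R x) = r *\<^sub>R (c *\<^sub>C x)" by (simp add: scaleR_scaleC scaleC_scaleC mult.commute)
  show "norm (c *\<^sub>C x) \<le> norm x * cmod c" by (simp add: norm_scaleC mult.commute)
qed

text \<open>For every \<open>T\<close> in \<open>bounded_ops\<close>, the operator \<open>S\<close> below exists (Riesz) and is unique.\<close>

definition adj_op :: "('a::complex_hilbert_space \<Rightarrow>\<^sub>L 'a) \<Rightarrow> ('a \<Rightarrow>\<^sub>L 'a)" where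
  "adj_op T = (THE S. S \<in> bounded_ops \<and>
     (\<forall>x y. cinner (blinfun_apply S x) y = cinner x (blinfun_apply T y)))"

definition positive_op :: "('a::complex_hilbert_space \<Rightarrow>\<^sub>L 'a) \<Rightarrow> bool" where
  "positive_op T \<longleftrightarrow> T \<in> bounded_ops \<and> (\<forall>x. cinner x (blinfun_apply T x) \<in> \<real>\<^sub>\<ge>\<^sub>0)"

definition op_le :: "('a::complex_hilbert_space \<Rightarrow>\<^sub>L 'a) \<Rightarrow> ('a \<Rightarrow>\<^sub>L 'a) \<Rightarrow> bool" where
  "op_le S T \<longleftrightarrow> positive_op (T - S)"


section \<open>Operator algebras\<close>

definition unital_subalgebra ::
    "('a::complex_hilbert_space \<Rightarrow>\<^sub>L 'a) set \<Rightarrow> ('a \<Rightarrow>\<^sub>L 'a) set \<Rightarrow> bool" where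
  "unital_subalgebra M A \<longleftrightarrow> A \<subseteq> M \<and> id_blinfun \<in> A \<and>
     (\<forall>a\<in>A. \<forall>b\<in>A. a + b \<in> A \<and> a o\<^sub>L b \<in> A) \<and>
     (\<forall>c. \<forall>a\<in>A. scalar_op c o\<^sub>L a \<in> A)"

definition commutant ::
    "('a::complex_hilbert_space \<Rightarrow>\<^sub>L 'a) set \<Rightarrow> ('a \<Rightarrow>\<^sub>L 'a) set" where
  "commutant S = {T \<in> bounded_ops. \<forall>s\<in>S. s o\<^sub>L T = T o\<^sub>L s}"

text \<open>
  A von Neumann algebra acting on the Hilbert space \<open>'a\<close>, in the formulation of Dixmier and Takesaki:
  a *-algebra of operators that equals its bicommutant.
\<close>

definition von_neumann_algebra :: "('a::complex_hilbert_space \<Rightarrow>\<^sub>L 'a) set \<Rightarrow> bool" where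
  "von_neumann_algebra M \<longleftrightarrow> unital_subalgebra bounded_ops M \<and>
     (\<forall>a\<in>M. adj_op a \<in> M) \<and> commutant (commutant M) = M"

definition factor :: "('a::complex_hilbert_space \<Rightarrow>\<^sub>L 'a) set \<Rightarrow> bool" where
  "factor M \<longleftrightarrow> von_neumann_algebra M \<and> M \<inter> commutant M = range scalar_op"

definition invertible_elements ::
    "('a::complex_hilbert_space \<Rightarrow>\<^sub>L 'a) set \<Rightarrow> ('a \<Rightarrow>\<^sub>L 'a) set" where
  "invertible_elements A =
     {a \<in> A. \<exists>b\<in>A. a o\<^sub>L b = id_blinfun \<and> b o\<^sub>L a = id_blinfun}"

definition logmodular ::
    "('a::complex_hilbert_space \<Rightarrow>\<^sub>L 'a) set \<Rightarrow> ('a \<Rightarrow>\<^sub>L 'a) set \<Rightarrow> bool" where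
  "logmodular M A \<longleftrightarrow>
     (let S = {adj_op a o\<^sub>L a | a. a \<in> invertible_elements A};
          P = {x \<in> invertible_elements M. positive_op x}
      in S \<subseteq> P \<and> P \<subseteq> closure S)"


section \<open>Invariant projections, nests and commutative subspace lattices\<close>

definition projections ::
    "('a::complex_hilbert_space \<Rightarrow>\<^sub>L 'a) set \<Rightarrow> ('a \<Rightarrow>\<^sub>L 'a) set" where
  "projections M = {p \<in> M. p o\<^sub>L p = p \<and> adj_op p = p}"

definition Lat ::
    "('a::complex_hilbert_space \<Rightarrow>\<^sub>L 'a) set \<Rightarrow> ('a \<Rightarrow>\<^sub>L 'a) set \<Rightarrow> ('a \<Rightarrow>\<^sub>L 'a) set" where
  "Lat M A = {p \<in> projections M. \<forall>a\<in>A. a o\<^sub>L p = p o\<^sub>L a o\<^sub>L p}"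

definition Alg ::
    "('a::complex_hilbert_space \<Rightarrow>\<^sub>L 'a) set \<Rightarrow> ('a \<Rightarrow>\<^sub>L 'a) set \<Rightarrow> ('a \<Rightarrow>\<^sub>L 'a) set" where
  "Alg M E = {x \<in> M. \<forall>p\<in>E. x o\<^sub>L p = p o\<^sub>L x o\<^sub>L p}"

definition reflexive_in ::
    "('a::complex_hilbert_space \<Rightarrow>\<^sub>L 'a) set \<Rightarrow> ('a \<Rightarrow>\<^sub>L 'a) set \<Rightarrow> bool" where
  "reflexive_in M A \<longleftrightarrow> A = Alg M (Lat M A)"

definition proj_order ::
    "('a::complex_hilbert_space \<Rightarrow>\<^sub>L 'a) set \<Rightarrow> ('a \<Rightarrow>\<^sub>L 'a) gorder" where
  "proj_order P = \<lparr>carrier = P, eq = (=), le = op_le\<rparr>"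

text \<open>A sublattice of the lattice of all projections of \<open>M\<close>.\<close>

definition projection_lattice ::
    "('a::complex_hilbert_space \<Rightarrow>\<^sub>L 'a) set \<Rightarrow> ('a \<Rightarrow>\<^sub>L 'a) set \<Rightarrow> bool" where
  "projection_lattice M E \<longleftrightarrow> E \<subseteq> projections M \<and>
     (\<forall>p\<in>E. \<forall>q\<in>E. p \<sqinter>\<^bsub>proj_order (projections M)\<^esub> q \<in> E \<and>
                   p \<squnion>\<^bsub>proj_order (projections M)\<^esub> q \<in> E)"

definition nest ::
    "('a::complex_hilbert_space \<Rightarrow>\<^sub>L 'a) set \<Rightarrow> ('a \<Rightarrow>\<^sub>L 'a) set \<Rightarrow> bool" where
  "nest M E \<longleftrightarrow> projection_lattice M E \<and> (\<forall>p\<in>E. \<forall>q\<in>E. op_le p q \<or> op_le q p)"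

definition nest_subalgebra ::
    "('a::complex_hilbert_space \<Rightarrow>\<^sub>L 'a) set \<Rightarrow> ('a \<Rightarrow>\<^sub>L 'a) set \<Rightarrow> bool" where
  "nest_subalgebra M A \<longleftrightarrow> (\<exists>E. nest M E \<and> A = Alg M E)"

definition csl :: "('a::complex_hilbert_space \<Rightarrow>\<^sub>L 'a) set \<Rightarrow> bool" where
  "csl E \<longleftrightarrow> projection_lattice bounded_ops E \<and> (\<forall>p\<in>E. \<forall>q\<in>E. p o\<^sub>L q = q o\<^sub>L p)"

text \<open>
  The distributive laws are those of the type class for completely distributive lattices in Main,
  relativised to a carrier: \<open>f\<close> ranges over the choice functions of the family \<open>F\<close>.
\<close>

definition completely_distributive :: "'b gorder \<Rightarrow> bool" where
  "completely_distributive L \<longleftrightarrow> complete_lattice L \<and>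
     (\<forall>F. F \<subseteq> Pow (carrier L) \<longrightarrow>
        \<Sqinter>\<^bsub>L\<^esub>((\<lambda>S. \<Squnion>\<^bsub>L\<^esub>S) ` F) = \<Squnion>\<^bsub>L\<^esub>{\<Sqinter>\<^bsub>L\<^esub>(f ` F) | f. \<forall>S\<in>F. f S \<in> S} \<and>
        \<Squnion>\<^bsub>L\<^esub>((\<lambda>S. \<Sqinter>\<^bsub>L\<^esub>S) ` F) = \<Sqinter>\<^bsub>L\<^esub>{\<Squnion>\<^bsub>L\<^esub>(f ` F) | f. \<forall>S\<in>F. f S \<in> S})"

definition completely_distributive_csl_algebra ::
    "('a::complex_hilbert_space \<Rightarrow>\<^sub>L 'a) set \<Rightarrow> bool" where
  "completely_distributive_csl_algebra A \<longleftrightarrow>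
     (\<exists>E. csl E \<and> completely_distributive (proj_order E) \<and> A = Alg bounded_ops E)"

end

theory Submission
  imports Defs
begin

text \<open>
  A reflexive algebra is \<open>Alg\<close> of its own lattice of invariant projections, so the point is that
  this lattice is a nest.  The mechanism is the following.  An element \<open>a\<close> of the algebra whose
  inverse also lies in the algebra maps the range of every invariant projection onto itself.  Given any
  invertible \<open>y\<close> of the von Neumann algebra, logmodularity provides such an \<open>a\<close> with \<open>a\<^sup>* a\<close>
  close to \<open>y\<^sup>* y\<close>, that is, with \<open>a y\<^sup>-\<^sup>1\<close> nearly isometric (\<open>logmodular_approx\<close>).  Hence for
  invariant projections \<open>p\<close> and \<open>q\<close> the pair of subspaces \<open>(y p H, y q H)\<close> is, up to an arbitrarily
  small error, congruent to \<open>(p H, q H)\<close>: no invertible \<open>y\<close> can change the relative position of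
  two invariant subspaces.

  If \<open>p\<close> and \<open>q\<close> did not commute, some angle between their ranges would lie strictly between \<open>0\<close>
  and a right angle.  Split \<open>q H\<close> by the spectral projection of \<open>q p q\<close> at \<open>1/2\<close> into the
  directions close to \<open>p H\<close> and those far from it (\<open>angle_splitting\<close>), and let \<open>y\<close> multiply the
  corresponding parts of \<open>p H\<close> by \<open>L\<close> and by \<open>1/L\<close> (\<open>two_scale_operator\<close>).  The first kind of
  angles becomes almost zero and the second almost right, so in the limit \<open>L \<longlongrightarrow> \<infinity>\<close> the projections
  commute (\<open>Lat_commute\<close>).

  For commuting \<open>p\<close> and \<open>q\<close> the corners \<open>e = p - p q\<close> and \<open>f = q - p q\<close> are orthogonal.  For every
  \<open>m\<close> in \<open>e M f\<close> the shear \<open>y = 1 + m\<close> is invertible and tilts \<open>f H\<close> towards \<open>e H\<close>, so \<open>m = 0\<close>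
  (\<open>commuting_Lat_corner_zero\<close>).  In a factor \<open>e M f = 0\<close> forces \<open>e = 0\<close> or \<open>f = 0\<close>
  (\<open>factor_prime\<close>), which says that \<open>p\<close> and \<open>q\<close> are comparable.  The statements about all bounded
  operators follow because they form a factor, and because every algebra of the form \<open>Alg E\<close> is
  reflexive.
\<close>

section \<open>Projections and adjoints in Hilbert space\<close>

text \<open>
  By the parallelogram law a minimising sequence for the distance from \<open>x\<close> to \<open>K\<close> is Cauchy, and a
  nearest point \<open>u\<close> has \<open>x - u\<close> orthogonal to \<open>K\<close> by first-order variation.
\<close>
lemma orthogonal_decomposition:
  fixes K :: "'a::{real_inner,complete_space} set"
  assumes "subspace K" "closed K"
  obtains u where "u \<in> K" "\<And>w. w \<in> K \<Longrightarrow> inner (x - u) w = 0"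
proof -
  define d where "d = infdist x K"
  have ne: "K \<noteq> {}" using subspace_0[OF assms(1)] by auto
  have "\<exists>u\<in>K. dist x u < d + inverse (real (Suc n))" for n
  proof -
    have "infdist x K < d + inverse (real (Suc n))" by (simp add: d_def)
    then show ?thesis
      using ne cINF_less_iff[of K "dist x"] by (auto simp: infdist_def)
  qed
  then obtain s where s: "\<And>n. s n \<in> K" "\<And>n. dist x (s n) < d + inverse (real (Suc n))"
    by metis
  have d_le: "d \<le> norm (x - u)" if "u \<in> K" for u
    using infdist_le[OF that, of x] by (simp add: d_def dist_norm)
  have lim: "(\<lambda>n. dist x (s n)) \<longlonglongrightarrow> d"
  proof (rule real_tendsto_sandwich)
    show "\<forall>\<^sub>F n in sequentially. d \<le> dist x (s n)"
      using d_le s(1) by (simp add: dist_norm)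
    show "\<forall>\<^sub>F n in sequentially. dist x (s n) \<le> d + inverse (real (Suc n))"
      using s(2) by (intro always_eventually allI less_imp_le)
    show "(\<lambda>n. d) \<longlonglongrightarrow> d" by simp
    show "(\<lambda>n. d + inverse (real (Suc n))) \<longlonglongrightarrow> d"
      using tendsto_add[OF tendsto_const LIMSEQ_inverse_real_of_nat, of d] by simp
  qed
  have d0: "d \<ge> 0" by (simp add: d_def infdist_nonneg)
  have para: "(norm (u - v))\<^sup>2 \<le> 2 * (norm (x - u))\<^sup>2 + 2 * (norm (x - v))\<^sup>2 - 4 * d\<^sup>2"
    if "u \<in> K" "v \<in> K" for u v
  proof -
    have "(1/2) *\<^sub>R (u + v) \<in> K"
      using that assms(1) by (simp add: subspace_add subspace_scale)
    then have "d\<^sup>2 \<le> (norm (x - (1/2) *\<^sub>R (u + v)))\<^sup>2"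
      using d_le d0 by (intro power_mono) auto
    moreover have "(norm (u - v))\<^sup>2 = 2 * (norm (x - u))\<^sup>2 + 2 * (norm (x - v))\<^sup>2
        - 4 * (norm (x - (1/2) *\<^sub>R (u + v)))\<^sup>2"
      by (simp add: power2_norm_eq_inner inner_diff_left inner_diff_right inner_add_left
          inner_add_right inner_commute algebra_simps)
    ultimately show ?thesis by linarith
  qed
  have "Cauchy s"
  proof (rule metric_CauchyI)
    fix e :: real assume e: "e > 0"
    have "(\<lambda>n. (dist x (s n))\<^sup>2) \<longlonglongrightarrow> d\<^sup>2" by (intro tendsto_power lim)
    then have "\<forall>\<^sub>F n in sequentially. (dist x (s n))\<^sup>2 < d\<^sup>2 + e\<^sup>2 / 4"
      using e by (intro order_tendstoD) auto
    then obtain N where N: "\<And>n. n \<ge> N \<Longrightarrow> (dist x (s n))\<^sup>2 < d\<^sup>2 + e\<^sup>2 / 4"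
      by (auto simp: eventually_sequentially)
    have "dist (s m) (s n) < e" if "m \<ge> N" "n \<ge> N" for m n
    proof -
      have "(norm (s m - s n))\<^sup>2 < e\<^sup>2"
        using para[OF s(1)[of m] s(1)[of n]] N[OF that(1)] N[OF that(2)]
        by (simp add: dist_norm)
      then show ?thesis using e by (simp add: dist_norm power_less_imp_less_base)
    qed
    then show "\<exists>M. \<forall>m\<ge>M. \<forall>n\<ge>M. dist (s m) (s n) < e" by blast
  qed
  then obtain u where u: "s \<longlonglongrightarrow> u" using Cauchy_convergent convergent_def by blast
  have uK: "u \<in> K" using closed_sequentially[OF assms(2)] s(1) u by blast
  have "(\<lambda>n. dist x (s n)) \<longlonglongrightarrow> dist x u" by (intro tendsto_intros u)
  then have du: "norm (x - u) = d" using LIMSEQ_unique lim by (metis dist_norm)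
  have "inner (x - u) w = 0" if w: "w \<in> K" for w
  proof (cases "w = 0")
    case False
    define t where "t = inner (x - u) w / (norm w)\<^sup>2"
    have "u + t *\<^sub>R w \<in> K" using uK w assms(1) by (simp add: subspace_add subspace_scale)
    then have "(norm (x - u))\<^sup>2 \<le> (norm (x - (u + t *\<^sub>R w)))\<^sup>2"
      using d_le du d0 by (intro power_mono) auto
    also have "\<dots> = (norm (x - u))\<^sup>2 - 2 * t * inner (x - u) w + t\<^sup>2 * (norm w)\<^sup>2"
      by (simp add: power2_norm_eq_inner inner_diff_left inner_diff_right inner_add_left
          inner_add_right inner_commute power2_eq_square[of t] algebra_simps)
    finally have "2 * t * inner (x - u) w \<le> t\<^sup>2 * (norm w)\<^sup>2" by simp
    moreover have "inner (x - u) w = t * (norm w)\<^sup>2" using False by (simp add: t_def)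
    ultimately have "t\<^sup>2 * (norm w)\<^sup>2 \<le> 0" by (simp add: power2_eq_square)
    then have "t = 0" using False by (simp add: mult_le_0_iff)
    then show ?thesis using False by (simp add: t_def)
  qed simp
  then show thesis using that uK by blast
qed

text \<open>
  The representing vector is a multiple of any \<open>n\<close> outside the kernel and orthogonal to it, as
  the kernel has codimension one.
\<close>
lemma riesz_representation:
  fixes f :: "'a::{real_inner,complete_space} \<Rightarrow> real"
  assumes "bounded_linear f"
  obtains z where "\<And>y. f y = inner z y"
proof (cases "\<forall>y. f y = 0")
  case True
  then show ?thesis using that[of 0] by simp
next
  case False
  interpret f: bounded_linear f by fact
  obtain x where x: "f x \<noteq> 0" using False by blast
  have "subspace {y. f y = 0}"
    by (auto simp: subspace_def f.add f.scaleR)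
  moreover have "closed {y. f y = 0}"
    by (intro closed_Collect_eq continuous_intros f.continuous_on)
  ultimately obtain u where u: "f u = 0" "\<And>w. f w = 0 \<Longrightarrow> inner (x - u) w = 0"
    using orthogonal_decomposition[of "{y. f y = 0}" x] by auto
  define n where "n = x - u"
  have fn: "f n \<noteq> 0" using x u by (simp add: n_def f.diff)
  then have n0: "n \<noteq> 0" by (auto simp: f.zero)
  have "f y = inner ((f n / (norm n)\<^sup>2) *\<^sub>R n) y" for y
  proof -
    have "f (y - (f y / f n) *\<^sub>R n) = 0" using fn by (simp add: f.diff f.scaleR)
    then have "inner n (y - (f y / f n) *\<^sub>R n) = 0" using u(2) by (simp add: n_def)
    then have "inner n y = (f y / f n) * (norm n)\<^sup>2"
      by (simp add: inner_diff_right power2_norm_eq_inner)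
    then show ?thesis using fn n0 by simp
  qed
  then show ?thesis using that by blast
qed

lemma real_adjoint_exists:
  fixes T :: "'a::{real_inner,complete_space} \<Rightarrow>\<^sub>L 'a"
  obtains S :: "'a \<Rightarrow>\<^sub>L 'a" where "\<And>x y. inner (S x) y = inner x (T y)"
proof -
  have "\<exists>z. \<forall>y. inner x (T y) = inner z y" for x
  proof -
    have "bounded_linear (\<lambda>y. inner x (T y))"
      by (intro bounded_linear_intros)
    then show ?thesis using riesz_representation by blast
  qed
  then obtain S where S: "\<And>x y. inner (S x) y = inner x (T y)" by metis
  have "bounded_linear S"
  proof (rule bounded_linear_intro)
    show "S (x + y) = S x + S y" for x y
      by (rule vector_eq_rdot[THEN iffD1]) (simp add: S inner_add_left)
    show "S (r *\<^sub>R x) = r *\<^sub>R S x" for r x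
      by (rule vector_eq_rdot[THEN iffD1]) (simp add: S)
    show "norm (S x) \<le> norm x * norm T" for x
    proof (cases "S x = 0")
      case False
      have "norm (S x) * norm (S x) = inner x (T (S x))"
        by (simp flip: S add: power2_norm_eq_inner[unfolded power2_eq_square])
      also have "\<dots> \<le> norm x * (norm T * norm (S x))"
        by (meson norm_cauchy_schwarz norm_blinfun mult_left_mono norm_ge_zero order_trans)
      finally show ?thesis using False by (simp add: mult.assoc[symmetric])
    qed simp
  qed
  then have "\<And>x y. inner (Blinfun S x) y = inner x (T y)"
    using S by (simp add: bounded_linear_Blinfun_apply)
  then show thesis using that by blast
qed

text \<open>
  For a complex-linear operator the complex inner product is determined by the real one.  Adjoints,
  positivity and all estimates below therefore use the real inner product only.
\<close>
lemma inner_scaleC_left: "inner (c *\<^sub>C x) (y :: 'a::complex_hilbert_space) = inner x (cnj c *\<^sub>C y)"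
proof -
  have "cinner x (cnj c *\<^sub>C y) = cnj c * cinner x y"
    using cinner_commute[of x "cnj c *\<^sub>C y"] cinner_commute[of x y]
    by (simp add: cinner_scaleC_left)
  then show ?thesis by (simp add: inner_eq_Re_cinner cinner_scaleC_left)
qed

lemma cinner_conv_inner: "cinner x y = Complex (inner x y) (inner (\<i> *\<^sub>C x) (y :: 'a::complex_hilbert_space))"
  by (simp add: complex_eq_iff inner_eq_Re_cinner cinner_scaleC_left)

lemma blinfun_eq_innerI:
  fixes S T :: "'a::real_inner \<Rightarrow>\<^sub>L 'a"
  assumes "\<And>x y. inner (S x) y = inner (T x) y"
  shows "S = T"
  by (rule blinfun_eqI, rule vector_eq_rdot[THEN iffD1]) (simp add: assms)

lemma adj_op_eqI:
  fixes S T :: "'a::complex_hilbert_space \<Rightarrow>\<^sub>L 'a"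
  assumes "S \<in> bounded_ops" "\<And>x y. inner (S x) y = inner x (T y)"
  shows "adj_op T = S"
  unfolding adj_op_def
proof (rule the_equality)
  have lin: "S (c *\<^sub>C x) = c *\<^sub>C S x" for c x using assms(1) by (simp add: bounded_ops_def)
  show "S \<in> bounded_ops \<and> (\<forall>x y. cinner (S x) y = cinner x (T y))"
    using assms by (simp add: cinner_conv_inner flip: lin)
next
  fix S' assume "S' \<in> bounded_ops \<and> (\<forall>x y. cinner (S' x) y = cinner x (T y))"
  then show "S' = S"
    by (intro blinfun_eq_innerI) (simp add: inner_eq_Re_cinner assms(2)[unfolded inner_eq_Re_cinner])
qed

lemma adj_op:
  fixes T :: "'a::complex_hilbert_space \<Rightarrow>\<^sub>L 'a"
  assumes "T \<in> bounded_ops"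
  shows adj_op_bounded: "adj_op T \<in> bounded_ops"
    and inner_adj_op: "\<And>x y. inner (adj_op T x) y = inner x (T y)"
    and inner_adj_op': "\<And>x y. inner (T x) y = inner x (adj_op T y)"
proof -
  obtain S where S: "\<And>x y. inner (blinfun_apply S x) y = inner x (T y)"
    using real_adjoint_exists by blast
  have lin: "T (c *\<^sub>C x) = c *\<^sub>C T x" for c x using assms by (simp add: bounded_ops_def)
  have "S (c *\<^sub>C x) = c *\<^sub>C S x" for c x
    by (rule vector_eq_rdot[THEN iffD1]) (simp add: S inner_scaleC_left flip: lin)
  then have "S \<in> bounded_ops" by (simp add: bounded_ops_def)
  moreover from this S have "adj_op T = S" by (rule adj_op_eqI)
  ultimately show "adj_op T \<in> bounded_ops" "\<And>x y. inner (adj_op T x) y = inner x (T y)"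
    "\<And>x y. inner (T x) y = inner x (adj_op T y)"
    using S by (auto simp: inner_commute)
qed

lemma adj_op_involutive:
  assumes "T \<in> bounded_ops"
  shows "adj_op (adj_op T) = T"
  using assms by (intro adj_op_eqI assms inner_adj_op')

lemma adj_op_compose:
  assumes "S \<in> bounded_ops" "T \<in> bounded_ops"
  shows "adj_op (S o\<^sub>L T) = adj_op T o\<^sub>L adj_op S"
proof (rule adj_op_eqI)
  show "adj_op T o\<^sub>L adj_op S \<in> bounded_ops"
    using adj_op_bounded[OF assms(1)] adj_op_bounded[OF assms(2)] by (simp add: bounded_ops_def)
qed (simp add: inner_adj_op assms)

lemma projection_onto_subspace:
  fixes K :: "'a::complex_hilbert_space set"
  assumes "subspace K" "closed K" and cpx: "\<And>c v. v \<in> K \<Longrightarrow> c *\<^sub>C v \<in> K"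
  obtains e where "e \<in> projections bounded_ops" "\<And>v. e v \<in> K" "\<And>v. v \<in> K \<Longrightarrow> e v = v"
    "\<And>v w. w \<in> K \<Longrightarrow> inner (v - e v) w = 0"
proof -
  have "\<exists>u\<in>K. \<forall>w\<in>K. inner (x - u) w = 0" for x
    using orthogonal_decomposition[OF assms(1,2)] by metis
  then obtain e where e: "\<And>v. e v \<in> K" "\<And>v w. w \<in> K \<Longrightarrow> inner (v - e v) w = 0" by metis
  have uniq: "e v = u" if "u \<in> K" "\<And>w. w \<in> K \<Longrightarrow> inner (v - u) w = 0" for u v
  proof -
    have "e v - u \<in> K" using e(1) that(1) assms(1) by (simp add: subspace_diff)
    then have "inner (v - u) (e v - u) = 0" "inner (v - e v) (e v - u) = 0" using that e by auto
    then have "inner (e v - u) (e v - u) = 0" by (simp add: inner_diff_left)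
    then show ?thesis by simp
  qed
  have eK: "e v = v" if "v \<in> K" for v using that by (intro uniq) auto
  have scC: "e (c *\<^sub>C v) = c *\<^sub>C e v" for c v
  proof (rule uniq)
    fix w assume "w \<in> K"
    then have "inner (v - e v) (cnj c *\<^sub>C w) = 0" using e cpx by blast
    moreover have "c *\<^sub>C (v - e v) = c *\<^sub>C v - c *\<^sub>C e v"
      using scaleC_add_right[of c "v - e v" "e v"] by (simp add: eq_diff_eq)
    ultimately show "inner (c *\<^sub>C v - c *\<^sub>C e v) w = 0"
      by (metis inner_scaleC_left)
  qed (use e cpx in auto)
  have bl: "bounded_linear e"
  proof (rule bounded_linear_intro)
    show add: "e (x + y) = e x + e y" for x y
    proof (rule uniq)
      fix w assume "w \<in> K"
      then have "inner (x - e x) w + inner (y - e y) w = 0" using e by simp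
      then show "inner (x + y - (e x + e y)) w = 0" by (simp add: inner_diff_left inner_add_left)
    qed (use e assms in \<open>auto intro: subspace_add\<close>)
    show "e (r *\<^sub>R x) = r *\<^sub>R e x" for r x by (simp add: scaleR_scaleC scC)
    show "norm (e x) \<le> norm x * 1" for x
    proof -
      have "inner (x - e x) (e x) = 0" using e by blast
      then have "(norm x)\<^sup>2 = (norm (e x))\<^sup>2 + (norm (x - e x))\<^sup>2"
        by (simp add: power2_norm_eq_inner inner_diff_left inner_diff_right inner_commute)
      then have "(norm (e x))\<^sup>2 \<le> (norm x)\<^sup>2" by simp
      then show ?thesis using power2_le_imp_le by fastforce
    qed
  qed
  define E where "E = Blinfun e"
  have E: "blinfun_apply E = e" using bl by (simp add: E_def bounded_linear_Blinfun_apply)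
  have B: "E \<in> bounded_ops" by (simp add: bounded_ops_def E scC)
  have "inner (e x) y = inner x (e y)" for x y
  proof -
    have "inner (x - e x) (e y) = 0" "inner (y - e y) (e x) = 0" using e by auto
    then show ?thesis by (simp add: inner_diff_left inner_diff_right inner_commute)
  qed
  then have "adj_op E = E" using B by (intro adj_op_eqI) (auto simp: E)
  moreover have "E o\<^sub>L E = E" by (rule blinfun_eqI) (simp add: E eK e)
  ultimately show thesis using that[of E] B E e eK by (auto simp: projections_def)
qed

text \<open>
  A subspace invariant under \<open>s\<close> and its adjoint has an orthogonal complement invariant under \<open>s\<close>.
\<close>
lemma projection_commutes_if_reducing:
  fixes s e :: "'a::complex_hilbert_space \<Rightarrow>\<^sub>L 'a"
  assumes s: "s \<in> bounded_ops" and e: "\<And>v. blinfun_apply e v \<in> K" "\<And>v. v \<in> K \<Longrightarrow> e v = v"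
      "\<And>v w. w \<in> K \<Longrightarrow> inner (v - e v) w = 0"
    and inv: "\<And>v. v \<in> K \<Longrightarrow> s v \<in> K" "\<And>v. v \<in> K \<Longrightarrow> adj_op s v \<in> K"
  shows "s o\<^sub>L e = e o\<^sub>L s"
proof (rule blinfun_eq_innerI)
  fix x y
  have "inner (x - e x) (adj_op s (e y)) = 0" "inner (y - e y) (s (e x)) = 0"
    "inner (s x - e (s x)) (e y) = 0" "inner (y - e y) (e (s x)) = 0"
    using e inv by auto
  then show "inner ((s o\<^sub>L e) x) y = inner ((e o\<^sub>L s) x) y"
    by (simp add: inner_diff_left blinfun.diff_right inner_diff_right inner_adj_op'[OF s, symmetric] inner_commute)
qed

lemma closed_selfadjoint:
  "closed {T :: 'a::real_inner \<Rightarrow>\<^sub>L 'a. \<forall>x y. inner (T x) y = inner x (T y)}"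
  by (intro closed_Collect_all closed_Collect_eq continuous_intros)

lemma closed_commuting:
  fixes s :: "'a::real_normed_vector \<Rightarrow>\<^sub>L 'a"
  shows "closed {T. s o\<^sub>L T = T o\<^sub>L s}"
  by (intro closed_Collect_eq bounded_linear.continuous_on[OF _ continuous_on_id]
          bounded_bilinear.bounded_linear_left[OF bounded_bilinear_blinfun_compose]
          bounded_bilinear.bounded_linear_right[OF bounded_bilinear_blinfun_compose])

text \<open>The space of operators is complete only over a codomain of class \<^class>\<open>banach\<close>.\<close>
instance complex_hilbert_space \<subseteq> banach ..

text \<open>
  \<open>B\<close> is the absolute value of \<open>k\<close>, the square root of \<open>k\<^sup>2 = 1 - y\<close>.  Writing \<open>B = 1 - Z\<close> turns
  \<open>B\<^sup>2 = 1 - y\<close> into the fixed point equation \<open>Z = (y + Z\<^sup>2) / 2\<close>.  Its iterates \<open>z n\<close>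
  starting from \<open>0\<close> are polynomials in \<open>y\<close>, so they commute with whatever commutes with \<open>k\<close>, and
  since \<open>norm y \<le> 1\<close> they and their increments are dominated by the iterates \<open>\<zeta> n\<close> of the scalar
  equation with \<open>y = 1\<close>, which increase and stay below \<open>1\<close>.
\<close>
lemma operator_absolute_value:
  fixes k :: "'a::{real_inner,banach} \<Rightarrow>\<^sub>L 'a"
  assumes sa: "\<And>x y. inner (k x) y = inner x (k y)" and k1: "norm k \<le> 1"
  obtains B :: "'a \<Rightarrow>\<^sub>L 'a" where "B o\<^sub>L B = k o\<^sub>L k" "\<And>x y. inner (B x) y = inner x (B y)"
    "\<And>v. inner (B v) v \<ge> 0" "\<And>s. s o\<^sub>L k = k o\<^sub>L s \<Longrightarrow> s o\<^sub>L B = B o\<^sub>L s"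
proof -
  define y where "y = id_blinfun - (k o\<^sub>L k)"
  define z where "z = rec_nat 0 (\<lambda>_ u. (1/2) *\<^sub>R (y + (u o\<^sub>L u)))"
  define \<zeta> where "\<zeta> = rec_nat 0 (\<lambda>_ t::real. (1 + t * t) / 2)"
  have z0: "z 0 = 0" and zS: "\<And>n. z (Suc n) = (1/2) *\<^sub>R (y + (z n o\<^sub>L z n))"
    by (simp_all add: z_def)
  have \<zeta>0: "\<zeta> 0 = 0" and \<zeta>S: "\<And>n. \<zeta> (Suc n) = (1 + \<zeta> n * \<zeta> n) / 2"
    by (simp_all add: \<zeta>_def)
  have kle: "norm (k v) \<le> norm v" for v
    using norm_blinfun[of k v] mult_right_mono[OF k1 norm_ge_zero[of v]] by simp
  have y1: "norm y \<le> 1"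
  proof (rule norm_blinfun_bound)
    fix v
    have "(norm (y v))\<^sup>2 = (norm v)\<^sup>2 - 2 * (norm (k v))\<^sup>2 + (norm (k (k v)))\<^sup>2"
      by (simp add: y_def blinfun.bilinear_simps power2_norm_eq_inner inner_diff_left
          inner_diff_right sa inner_commute)
    also have "\<dots> \<le> (norm v)\<^sup>2 - 2 * (norm (k v))\<^sup>2 + (norm (k v))\<^sup>2"
      using power_mono[OF kle[of "k v"] norm_ge_zero, of 2] by simp
    also have "\<dots> \<le> (norm v)\<^sup>2" by simp
    finally have "norm (y v) \<le> norm v" by (rule power2_le_imp_le) simp
    then show "norm (y v) \<le> 1 * norm v" by simp
  qed simp
  have comm: "s o\<^sub>L z n = z n o\<^sub>L s" if s: "s o\<^sub>L k = k o\<^sub>L s" for s n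
  proof -
    have sk: "s (k v) = k (s v)" for v
      using arg_cong[OF s, of "\<lambda>T. blinfun_apply T v"] by simp
    have "\<forall>v. s (z n v) = z n (s v)"
      by (induction n) (simp_all add: z0 zS y_def blinfun.bilinear_simps sk)
    then show ?thesis by (intro blinfun_eqI) simp
  qed
  have zz: "z m o\<^sub>L z n = z n o\<^sub>L z m" for m n
    using comm[OF comm[OF refl, symmetric]] .
  have zsa: "\<forall>v w. inner (z n v) w = inner v (z n w)" for n
    by (induction n) (simp_all add: z0 zS y_def blinfun.bilinear_simps inner_add_left
        inner_add_right inner_diff_left inner_diff_right sa)
  have \<zeta>: "0 \<le> \<zeta> n \<and> \<zeta> n \<le> 1" for n
  proof (induction n)
    case (Suc n)
    then have "\<zeta> n * \<zeta> n \<le> 1" by (simp add: mult_le_one)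
    then show ?case using Suc by (simp add: \<zeta>S)
  qed (simp add: \<zeta>0)
  have zn: "norm (z n) \<le> \<zeta> n" for n
  proof (induction n)
    case (Suc n)
    have "norm (z (Suc n)) \<le> (1/2) * (norm y + norm (z n o\<^sub>L z n))"
      using norm_triangle_ineq[of y "z n o\<^sub>L z n"] by (simp add: zS)
    also have "norm (z n o\<^sub>L z n) \<le> norm (z n) * norm (z n)" by (rule norm_blinfun_compose)
    also have "norm (z n) * norm (z n) \<le> \<zeta> n * \<zeta> n" using Suc \<zeta> by (intro mult_mono) auto
    finally show ?case using y1 by (simp add: \<zeta>S)
  qed (simp add: z0 \<zeta>0)
  have step: "norm (z (Suc n) - z n) \<le> \<zeta> (Suc n) - \<zeta> n" for n
  proof (induction n)
    case 0
    then show ?case using y1 by (simp add: z0 zS[of 0] \<zeta>0 \<zeta>S)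
  next
    case (Suc n)
    have c: "z (Suc n) (z n v) = z n (z (Suc n) v)" for v
      using arg_cong[OF zz[of "Suc n" n], of "\<lambda>T. blinfun_apply T v"] by simp
    \<comment> \<open>Difference of two commuting squares.\<close>
    have "z (Suc (Suc n)) - z (Suc n) = (1/2) *\<^sub>R ((z (Suc n) + z n) o\<^sub>L (z (Suc n) - z n))"
      unfolding zS[of "Suc n"] zS[of n, THEN arg_cong[of _ _ "\<lambda>t. _ - t"]]
      by (rule blinfun_eqI) (simp add: blinfun.bilinear_simps c scaleR_diff_right[symmetric]
          del: scaleR_half_double)
    then have "norm (z (Suc (Suc n)) - z (Suc n))
        = (1/2) * norm ((z (Suc n) + z n) o\<^sub>L (z (Suc n) - z n))" by simp
    also have "\<dots> \<le> (1/2) * (norm (z (Suc n) + z n) * norm (z (Suc n) - z n))"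
      using norm_blinfun_compose by (intro mult_left_mono) auto
    also have "\<dots> \<le> (1/2) * ((\<zeta> (Suc n) + \<zeta> n) * (\<zeta> (Suc n) - \<zeta> n))"
      using Suc \<zeta>[of n] \<zeta>[of "Suc n"] zn[of n] zn[of "Suc n"] norm_triangle_ineq[of "z (Suc n)" "z n"]
      by (intro mult_left_mono mult_mono) (linarith | simp)+
    also have "\<dots> = \<zeta> (Suc (Suc n)) - \<zeta> (Suc n)"
      unfolding \<zeta>S[of "Suc n"] by (simp add: \<zeta>S[of n] field_simps)
    finally show ?case .
  qed
  have "incseq \<zeta>"
    by (rule incseq_SucI) (use step norm_ge_zero order_trans diff_ge_0_iff_ge in blast)
  then have "convergent \<zeta>" using \<zeta> by (intro Bseq_mono_convergent BseqI'[of _ 1]) (auto simp: incseq_def)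
  then have "summable (\<lambda>n. \<zeta> (Suc n) - \<zeta> n)"
    using telescope_summable convergent_def by blast
  then have "summable (\<lambda>n. norm (z (Suc n) - z n))"
    by (rule summable_comparison_test'[of _ 0]) (use step in auto)
  then have "summable (\<lambda>n. z (Suc n) - z n)" by (rule summable_norm_cancel)
  then have "(\<lambda>n. \<Sum>i<n. z (Suc i) - z i) \<longlonglongrightarrow> (\<Sum>n. z (Suc n) - z n)"
    by (rule summable_LIMSEQ)
  moreover have "(\<lambda>n. \<Sum>i<n. z (Suc i) - z i) = z"
    by (simp add: sum_lessThan_telescope z0 fun_eq_iff)
  ultimately obtain Z where Z: "z \<longlonglongrightarrow> Z" by metis
  have "(\<lambda>n. z (Suc n)) \<longlonglongrightarrow> (1/2) *\<^sub>R (y + (Z o\<^sub>L Z))"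
    unfolding zS by (intro tendsto_intros bounded_bilinear.tendsto[OF bounded_bilinear_blinfun_compose] Z)
  then have fixpt: "Z = (1/2) *\<^sub>R (y + (Z o\<^sub>L Z))"
    using LIMSEQ_unique LIMSEQ_Suc[OF Z] by blast
  have Zsa: "inner (Z v) w = inner v (Z w)" for v w
    using closed_sequentially[OF closed_selfadjoint, of z Z] zsa Z by blast
  have "norm Z \<le> 1"
    using Z zn \<zeta> by (intro LIMSEQ_le_const2[OF tendsto_norm[OF Z]]) (meson order_trans)
  then have Z1: "norm (Z v) \<le> norm v" for v
    using norm_blinfun[of Z v] mult_right_mono[of "norm Z" 1 "norm v"] by simp
  define B where "B = id_blinfun - Z"
  show thesis
  proof (rule that[of B])
    have "2 *\<^sub>R Z v = v - k (k v) + Z (Z v)" for v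
      using arg_cong[OF fixpt, of "\<lambda>T. 2 *\<^sub>R blinfun_apply T v"]
      by (simp add: y_def blinfun.bilinear_simps)
    then show "B o\<^sub>L B = k o\<^sub>L k"
      by (intro blinfun_eqI) (simp add: B_def blinfun.bilinear_simps scaleR_2 algebra_simps)
    show "inner (B v) w = inner v (B w)" for v w
      by (simp add: B_def blinfun.bilinear_simps inner_diff_left inner_diff_right Zsa)
    show "inner (B v) v \<ge> 0" for v
    proof -
      have "inner (Z v) v \<le> norm v * norm v"
        using norm_cauchy_schwarz[of "Z v" v] mult_right_mono[OF Z1[of v] norm_ge_zero[of v]] by simp
      then show ?thesis
        by (simp add: B_def blinfun.bilinear_simps inner_diff_left flip: power2_norm_eq_inner)
          (simp add: power2_eq_square)
    qed
    show "s o\<^sub>L B = B o\<^sub>L s" if "s o\<^sub>L k = k o\<^sub>L s" for s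
    proof -
      have *: "s o\<^sub>L Z = Z o\<^sub>L s"
        using closed_sequentially[OF closed_commuting[of s], of z Z] comm[OF that] Z by blast
      have "s (Z v) = Z (s v)" for v using arg_cong[OF *, of "\<lambda>T. blinfun_apply T v"] by simp
      then show ?thesis by (intro blinfun_eqI) (simp add: B_def blinfun.bilinear_simps)
    qed
  qed
qed

text \<open>Taking adjoints turns commutation with \<open>a\<^sup>*\<close> into commutation of the adjoint with \<open>a\<close>.\<close>
lemma adj_op_commutant:
  assumes M: "M \<subseteq> bounded_ops" "\<And>a. a \<in> M \<Longrightarrow> adj_op a \<in> M" and s: "s \<in> commutant M"
  shows "adj_op s \<in> commutant M"
proof -
  have sb: "s \<in> bounded_ops" using s by (simp add: commutant_def)
  have "m o\<^sub>L adj_op s = adj_op s o\<^sub>L m" if m: "m \<in> M" for m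
  proof -
    have mb: "m \<in> bounded_ops" using m M by blast
    have "adj_op m o\<^sub>L s = s o\<^sub>L adj_op m" using s M(2)[OF m] by (simp add: commutant_def)
    then have "adj_op (adj_op m o\<^sub>L s) = adj_op (s o\<^sub>L adj_op m)" by simp
    then show ?thesis using sb mb by (simp add: adj_op_compose adj_op_bounded adj_op_involutive)
  qed
  then show ?thesis using adj_op_bounded[OF sb] by (simp add: commutant_def)
qed

lemma projectionsD:
  fixes p :: "'a::complex_hilbert_space \<Rightarrow>\<^sub>L 'a"
  assumes "p \<in> projections M" "M \<subseteq> bounded_ops"
  shows "p \<in> M" "p \<in> bounded_ops" "\<And>v. p (p v) = p v" "\<And>x y. inner (p x) y = inner x (p y)"
proof -
  show "p \<in> M" "p \<in> bounded_ops" using assms by (auto simp: projections_def)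
  then show "inner (p x) y = inner x (p y)" for x y
    using assms inner_adj_op[of p x y] by (simp add: projections_def)
  have "(p o\<^sub>L p) v = p v" for v using assms by (simp add: projections_def)
  then show "p (p v) = p v" for v by simp
qed

section \<open>Projections in a von Neumann algebra\<close>

locale von_neumann =
  fixes M :: "('a::complex_hilbert_space \<Rightarrow>\<^sub>L 'a) set"
  assumes vN: "von_neumann_algebra M"
begin

lemma bounded: "M \<subseteq> bounded_ops" and id_mem: "id_blinfun \<in> M"
  and add_mem: "a \<in> M \<Longrightarrow> b \<in> M \<Longrightarrow> a + b \<in> M"
  and compose_mem: "a \<in> M \<Longrightarrow> b \<in> M \<Longrightarrow> a o\<^sub>L b \<in> M"
  and scalar_mem: "a \<in> M \<Longrightarrow> scalar_op c o\<^sub>L a \<in> M"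
  and adj_mem: "a \<in> M \<Longrightarrow> adj_op a \<in> M"
  and bicommutant: "commutant (commutant M) = M"
  using vN by (auto simp: von_neumann_algebra_def unital_subalgebra_def)

lemma scaleR_mem: "a \<in> M \<Longrightarrow> r *\<^sub>R a \<in> M"
proof -
  have "r *\<^sub>R a = scalar_op (of_real r) o\<^sub>L a" for a :: "'a \<Rightarrow>\<^sub>L 'a"
    by (rule blinfun_eqI) (simp add: scalar_op.rep_eq scaleR_scaleC blinfun.bilinear_simps)
  then show "a \<in> M \<Longrightarrow> r *\<^sub>R a \<in> M" using scalar_mem by simp
qed

lemma diff_mem: "a \<in> M \<Longrightarrow> b \<in> M \<Longrightarrow> a - b \<in> M"
  using add_mem[OF _ scaleR_mem[of b "-1"], of a] by simp

text \<open>
  The commutant is closed under adjoints, so \<open>K\<close> reduces it and the projection onto \<open>K\<close> lies in the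
  bicommutant.
\<close>
lemma invariant_projection_mem:
  assumes K: "subspace K" "closed K" "\<And>c v. v \<in> K \<Longrightarrow> c *\<^sub>C v \<in> K"
    and inv: "\<And>s v. s \<in> commutant M \<Longrightarrow> v \<in> K \<Longrightarrow> s v \<in> K"
  obtains e where "e \<in> projections M" "\<And>v. e v \<in> K" "\<And>v. v \<in> K \<Longrightarrow> e v = v"
    "\<And>v w. w \<in> K \<Longrightarrow> inner (v - e v) w = 0"
proof -
  obtain e where e: "e \<in> projections bounded_ops" "\<And>v. blinfun_apply e v \<in> K"
    "\<And>v. v \<in> K \<Longrightarrow> e v = v" "\<And>v w. w \<in> K \<Longrightarrow> inner (v - e v) w = 0"
    using projection_onto_subspace[OF K] by metis
  have "s o\<^sub>L e = e o\<^sub>L s" if s: "s \<in> commutant M" for s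
    using s inv adj_op_commutant[OF bounded adj_mem s] e
    by (intro projection_commutes_if_reducing[of s e K]) (auto simp: commutant_def)
  then have "e \<in> commutant (commutant M)"
    using e(1) by (auto simp: commutant_def projections_def)
  then have "e \<in> projections M" using e(1) bicommutant by (simp add: projections_def)
  then show thesis using that e by blast
qed

lemma kernel_subspace:
  fixes T :: "'a \<Rightarrow>\<^sub>L 'a"
  shows "subspace {v. T v = 0}" "closed {v. T v = 0}"
    "T \<in> M \<Longrightarrow> T v = 0 \<Longrightarrow> T (c *\<^sub>C v) = 0"
proof -
  show "subspace {v. T v = 0}" by (simp add: subspace_def blinfun.bilinear_simps)
  show "closed {v. T v = 0}" by (intro closed_Collect_eq continuous_intros)
  have "c *\<^sub>C (0::'a) = 0" using norm_scaleC[of c "0::'a"] by simp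
  then show "T \<in> M \<Longrightarrow> T v = 0 \<Longrightarrow> T (c *\<^sub>C v) = 0"
    using bounded by (auto simp: bounded_ops_def)
qed

lemma kernel_projection:
  assumes T: "T \<in> M"
  obtains e where "e \<in> projections M" "\<And>v. T (e v) = 0" "\<And>v. T v = 0 \<Longrightarrow> e v = v"
    "\<And>v w. T w = 0 \<Longrightarrow> inner (v - e v) w = 0"
proof -
  have "T (s v) = 0" if "s \<in> commutant M" "T v = 0" for s v
  proof -
    have "T o\<^sub>L s = s o\<^sub>L T" using that T by (simp add: commutant_def)
    then have "T (s v) = s (T v)" by (metis blinfun_apply_blinfun_compose)
    then show ?thesis using that by (simp add: blinfun.bilinear_simps)
  qed
  then have inv: "s v \<in> {v. T v = 0}" if "s \<in> commutant M" "v \<in> {v. T v = 0}" for s v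
    using that by simp
  have sc: "c *\<^sub>C v \<in> {v. T v = 0}" if "v \<in> {v. T v = 0}" for c v
    using kernel_subspace(3)[OF T] that by simp
  obtain e where e: "e \<in> projections M" "\<And>v. blinfun_apply e v \<in> {v. T v = 0}"
    "\<And>v. v \<in> {v. T v = 0} \<Longrightarrow> e v = v" "\<And>v w. w \<in> {v. T v = 0} \<Longrightarrow> inner (v - e v) w = 0"
    by (rule invariant_projection_mem[OF kernel_subspace(1,2) sc inv]) blast+
  show thesis
    by (rule that[OF e(1)]) (use e(2-4) in simp_all)
qed

text \<open>
  \<open>F\<close> is the spectral projection of \<open>k\<close> for the half-line from \<open>0\<close>, obtained as the projection onto
  the kernel of \<open>\<bar>k\<bar> - k\<close>.  On that kernel \<open>k = \<bar>k\<bar>\<close>; on its orthogonal complement \<open>k = -\<bar>k\<bar>\<close>,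
  because \<open>(\<bar>k\<bar> - k) (\<bar>k\<bar> + k) = 0\<close> places the range of \<open>\<bar>k\<bar> + k\<close> inside the kernel.
\<close>
lemma spectral_projection:
  assumes k: "k \<in> M" and sa: "adj_op k = k" and k1: "norm k \<le> 1"
  obtains F where "F \<in> projections M" "\<And>v. inner (k (F v)) (F v) \<ge> 0"
    "\<And>v. inner (k (v - F v)) (v - F v) \<le> 0"
    "\<And>s v. s \<in> bounded_ops \<Longrightarrow> adj_op s = s \<Longrightarrow> s o\<^sub>L k = k o\<^sub>L s \<Longrightarrow> s (F v) = F (s v)"
proof -
  have kb: "k \<in> bounded_ops" using k bounded by blast
  have ksa: "inner (k x) y = inner x (k y)" for x y
    using inner_adj_op[OF kb, of x y] sa by simp
  obtain B :: "'a \<Rightarrow>\<^sub>L 'a" where B: "B o\<^sub>L B = k o\<^sub>L k" "\<And>x y. inner (B x) y = inner x (B y)"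
    "\<And>v. inner (B v) v \<ge> 0" "\<And>s. s o\<^sub>L k = k o\<^sub>L s \<Longrightarrow> s o\<^sub>L B = B o\<^sub>L s"
    using operator_absolute_value[OF ksa k1] by blast
  have BB: "B (B v) = k (k v)" for v using arg_cong[OF B(1), of "\<lambda>T. blinfun_apply T v"] by simp
  have sB: "s (B v) = B (s v)" if "s o\<^sub>L k = k o\<^sub>L s" for s v
    using arg_cong[OF B(4)[OF that], of "\<lambda>T. blinfun_apply T v"] by simp
  have kB: "k (B v) = B (k v)" for v by (rule sB) simp
  have "scalar_op c o\<^sub>L k = k o\<^sub>L scalar_op c" for c
    using kb by (intro blinfun_eqI) (simp add: scalar_op.rep_eq bounded_ops_def)
  from sB[OF this] have "B \<in> bounded_ops" by (simp add: bounded_ops_def scalar_op.rep_eq)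
  moreover have "s o\<^sub>L B = B o\<^sub>L s" if "s \<in> commutant M" for s
    using that k B(4)[of s] by (simp add: commutant_def)
  ultimately have "B \<in> commutant (commutant M)" by (auto simp: commutant_def[of "commutant M"])
  then have "B \<in> M" by (simp add: bicommutant)
  then have "B - k \<in> M" using k by (rule diff_mem)
  then obtain F where F: "F \<in> projections M" "\<And>v. (B - k) (F v) = 0" "\<And>v. (B - k) v = 0 \<Longrightarrow> F v = v"
    "\<And>v w. (B - k) w = 0 \<Longrightarrow> inner (v - F v) w = 0"
    using kernel_projection by metis
  have kF: "k (F v) = B (F v)" for v using F(2)[of v] by (simp add: blinfun.bilinear_simps)
  have kF': "k (v - F v) = - B (v - F v)" for v
  proof -
    have "inner (k (v - F v) + B (v - F v)) w = 0" for w
    proof -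
      have "(B - k) (k w + B w) = 0" by (simp add: blinfun.bilinear_simps kB BB)
      then have "inner (v - F v) (k w + B w) = 0" by (rule F)
      then show ?thesis by (simp only: inner_add_left inner_add_right ksa B(2))
    qed
    then show ?thesis by (metis inner_eq_zero_iff add_eq_0_iff2)
  qed
  show thesis
  proof (rule that[OF F(1)])
    show "inner (k (F v)) (F v) \<ge> 0" for v by (simp add: kF B(3))
    show "inner (k (v - F v)) (v - F v) \<le> 0" for v unfolding kF' using B(3) by simp
    fix s v assume s: "s \<in> bounded_ops" "adj_op s = s" "s o\<^sub>L k = k o\<^sub>L s"
    have sk: "s (k v) = k (s v)" for v
      using arg_cong[OF s(3), of "\<lambda>T. blinfun_apply T v"] by simp
    have inv: "(B - k) (s v) = 0" if "(B - k) v = 0" for v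
    proof -
      have "(B - k) (s v) = s ((B - k) v)" by (simp add: blinfun.bilinear_simps sk sB[OF s(3)])
      then show ?thesis using that by (simp add: blinfun.bilinear_simps)
    qed
    have "s o\<^sub>L F = F o\<^sub>L s"
      by (rule projection_commutes_if_reducing[of s F "{v. (B - k) v = 0}"])
        (use s F inv in auto)
    then show "s (F v) = F (s v)" by (metis blinfun_apply_blinfun_compose)
  qed
qed

end

section \<open>Moving invariant subspaces by logmodularity\<close>

lemma positive_op_iff:
  assumes "T \<in> bounded_ops" "\<And>x y. inner (blinfun_apply T x) y = inner x (T y)"
  shows "positive_op T \<longleftrightarrow> (\<forall>v. inner v (T v) \<ge> 0)"
proof -
  have "inner (\<i> *\<^sub>C v) (T v) = 0" for v
  proof -
    have "inner (\<i> *\<^sub>C v) (T v) = inner (\<i> *\<^sub>C T v) v"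
      using assms by (simp add: bounded_ops_def flip: assms(2))
    also have "\<dots> = - inner (\<i> *\<^sub>C v) (T v)"
    proof -
      have "inner (\<i> *\<^sub>C x) y = - inner (\<i> *\<^sub>C y) x" for x y :: 'a
        using cinner_commute[of x y] by (simp add: cinner_conv_inner complex_eq_iff)
      then show ?thesis .
    qed
    finally show ?thesis by simp
  qed
  then show ?thesis
    using assms(1) by (simp add: positive_op_def cinner_conv_inner complex_nonneg_Reals_iff)
qed

lemma adj_op_id: "adj_op id_blinfun = (id_blinfun :: 'a::complex_hilbert_space \<Rightarrow>\<^sub>L 'a)"
  by (rule adj_op_eqI) (simp_all add: bounded_ops_def)

context von_neumann
begin

lemma modulus_square_mem:
  assumes "y \<in> invertible_elements M"
  shows "adj_op y o\<^sub>L y \<in> invertible_elements M" "positive_op (adj_op y o\<^sub>L y)"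
proof -
  obtain b where b: "b \<in> M" "y o\<^sub>L b = id_blinfun" "b o\<^sub>L y = id_blinfun" and y: "y \<in> M"
    using assms by (auto simp: invertible_elements_def)
  have yb: "y \<in> bounded_ops" "b \<in> bounded_ops" using y b bounded by auto
  have 1: "adj_op b o\<^sub>L adj_op y = id_blinfun" "adj_op y o\<^sub>L adj_op b = id_blinfun"
    using b yb by (simp_all add: adj_op_id flip: adj_op_compose)
  have *: "y (b v) = v" "b (y v) = v" "adj_op b (adj_op y v) = v" "adj_op y (adj_op b v) = v" for v
    using 1 b(2,3) by (metis blinfun_apply_blinfun_compose blinfun_apply_id_blinfun id_apply)+
  have "(adj_op y o\<^sub>L y) o\<^sub>L (b o\<^sub>L adj_op b) = id_blinfun"
    "(b o\<^sub>L adj_op b) o\<^sub>L (adj_op y o\<^sub>L y) = id_blinfun"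
    by (rule blinfun_eqI; simp add: *)+
  then show "adj_op y o\<^sub>L y \<in> invertible_elements M"
    using y b by (auto simp: invertible_elements_def intro!: compose_mem adj_mem)
  have "adj_op y o\<^sub>L y \<in> bounded_ops" using y bounded compose_mem adj_mem by blast
  then show "positive_op (adj_op y o\<^sub>L y)"
    using inner_adj_op[OF yb(1)] inner_adj_op'[OF yb(1)]
    by (subst positive_op_iff) (simp_all, metis inner_ge_zero)
qed

text \<open>
  The error is measured against \<open>y u\<close> and \<open>y v\<close> rather than \<open>u\<close> and \<open>v\<close>, so that the conclusion
  says that \<open>a y\<^sup>-\<^sup>1\<close> is an isometry up to \<open>\<epsilon>\<close>; this costs the factor \<open>c\<^sup>2\<close> in the
  choice of \<open>\<eta>\<close>, where \<open>c\<close> bounds the norm of the inverse of \<open>y\<close>.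
\<close>
lemma logmodular_approx:
  assumes A: "unital_subalgebra M A" "logmodular M A" and y: "y \<in> invertible_elements M"
    and \<epsilon>: "\<epsilon> > 0"
  obtains a a' where "a \<in> A" "a' \<in> A" "\<And>v. a (blinfun_apply a' v) = v" "\<And>v. a' (blinfun_apply a v) = v"
    "\<And>u v. \<bar>inner (a u) (a v) - inner (y u) (y v)\<bar> \<le> \<epsilon> * (norm (y u) * norm (y v))"
proof -
  obtain b where b: "b o\<^sub>L y = id_blinfun" and yM: "y \<in> M"
    using y by (auto simp: invertible_elements_def)
  define c where "c = 1 + norm b"
  have n1: "c > 0" by (simp add: c_def add_pos_nonneg)
  have b': "norm u \<le> c * norm (y u)" for u
  proof -
    have "norm u \<le> norm b * norm (y u)"
      using norm_blinfun[of b "y u"] arg_cong[OF b, of "\<lambda>T. norm (blinfun_apply T u)"] by simp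
    then show ?thesis by (simp add: c_def distrib_right add_increasing)
  qed
  define \<eta> where "\<eta> = \<epsilon> / c\<^sup>2"
  have \<eta>: "\<eta> > 0" using \<epsilon> n1 by (simp add: \<eta>_def)
  have "adj_op y o\<^sub>L y \<in> closure {adj_op a o\<^sub>L a | a. a \<in> invertible_elements A}"
    using A(2) modulus_square_mem[OF y] by (auto simp: logmodular_def Let_def)
  then obtain a where a: "a \<in> invertible_elements A" "dist (adj_op a o\<^sub>L a) (adj_op y o\<^sub>L y) < \<eta>"
    using \<eta> by (auto simp: closure_approachable)
  then obtain a' where a': "a \<in> A" "a' \<in> A" "a o\<^sub>L a' = id_blinfun" "a' o\<^sub>L a = id_blinfun"
    by (auto simp: invertible_elements_def)
  have ab: "a \<in> bounded_ops" "y \<in> bounded_ops"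
    using a' A(1) bounded yM by (auto simp: unital_subalgebra_def)
  show thesis
  proof (rule that[OF a'(1,2)])
    show "a (a' v) = v" "a' (a v) = v" for v
      using a'(3,4) by (metis blinfun_apply_blinfun_compose blinfun_apply_id_blinfun id_apply)+
    fix u v
    define D where "D = (adj_op a o\<^sub>L a) - (adj_op y o\<^sub>L y)"
    have "inner (a u) (a v) - inner (y u) (y v) = inner u (D v)"
      using ab by (simp add: D_def blinfun.bilinear_simps inner_diff_right inner_adj_op')
    also have "\<bar>\<dots>\<bar> \<le> norm u * norm (D v)" by (rule Cauchy_Schwarz_ineq2)
    also have "\<dots> \<le> norm u * (\<eta> * norm v)"
    proof (rule mult_left_mono)
      have "norm D \<le> \<eta>" using a(2) by (simp add: D_def dist_norm)
      then show "norm (D v) \<le> \<eta> * norm v"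
        using norm_blinfun[of D v] mult_right_mono[of "norm D" \<eta> "norm v"] by simp
    qed simp
    also have "\<dots> \<le> (c * norm (y u)) * (\<eta> * (c * norm (y v)))"
      using \<eta> n1 b' by (intro mult_mono mult_left_mono mult_nonneg_nonneg) auto
    also have "\<dots> = (\<eta> * c\<^sup>2) * (norm (y u) * norm (y v))" by (simp add: power2_eq_square)
    also have "\<eta> * c\<^sup>2 = \<epsilon>" using n1 by (simp add: \<eta>_def)
    finally show "\<bar>inner (a u) (a v) - inner (y u) (y v)\<bar> \<le> \<epsilon> * (norm (y u) * norm (y v))" .
  qed
qed

end

lemma Lat_apply: "r \<in> Lat M A \<Longrightarrow> a \<in> A \<Longrightarrow> r (a (r v)) = a (blinfun_apply r v)"
  by (simp add: Lat_def) (metis blinfun_apply_blinfun_compose)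

text \<open>
  If \<open>y v\<close> is orthogonal to the image under \<open>y\<close> of the range of \<open>r\<close>, then \<open>a v\<close> is almost
  orthogonal to the range of \<open>r\<close>: that range is \<open>a\<close> applied to itself, so \<open>r (a v) = a z\<close> with
  \<open>z\<close> in it, and the square of its norm is \<open>inner (a v) (a z)\<close>, which is close to
  \<open>inner (y v) (y z) = 0\<close>.
\<close>
lemma near_isometry_orthogonal:
  fixes a a' y r :: "'a::real_inner \<Rightarrow>\<^sub>L 'a"
  assumes near: "\<And>u v. \<bar>inner (a u) (a v) - inner (y u) (y v)\<bar> \<le> \<epsilon> * (norm (y u) * norm (y v))"
    and \<epsilon>: "0 \<le> \<epsilon>" "\<epsilon> \<le> 1/2"
    and inv: "\<And>v. a (a' v) = v"
    and r: "\<And>u v. inner (r u) v = inner u (r v)" "\<And>v. r (r v) = r v" "\<And>v. r (a' (r v)) = a' (r v)"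
    and orth: "\<And>z. inner (y v) (y (r z)) = 0"
  shows "norm (r (a v)) \<le> 2 * \<epsilon> * norm (y v)"
proof -
  define z where "z = a' (r (a v))"
  have z: "r z = z" "a z = r (a v)" by (simp_all add: z_def inv r)
  have "(norm (y z))\<^sup>2 - (norm (a z))\<^sup>2 \<le> \<epsilon> * (norm (y z))\<^sup>2"
    using near[of z z] by (simp add: power2_norm_eq_inner[symmetric] power2_eq_square[symmetric])
  also have "\<dots> \<le> (1/2) * (norm (y z))\<^sup>2" using \<epsilon> by (intro mult_right_mono) auto
  finally have "(norm (y z))\<^sup>2 \<le> 2 * (norm (a z))\<^sup>2" by simp
  also have "\<dots> \<le> (2 * norm (a z))\<^sup>2" by (simp add: power_mult_distrib)
  finally have yz: "norm (y z) \<le> 2 * norm (a z)" by (rule power2_le_imp_le) simp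
  have "(norm (a z))\<^sup>2 = inner (a v) (a z)"
    by (simp add: z power2_norm_eq_inner r)
  also have "\<dots> \<le> \<epsilon> * (norm (y v) * norm (y z))"
    using near[of v z] orth[of z] by (simp add: z)
  also have "\<dots> \<le> \<epsilon> * (norm (y v) * (2 * norm (a z)))"
    using yz \<epsilon> by (intro mult_left_mono) auto
  finally have "norm (a z) * norm (a z) \<le> (2 * \<epsilon> * norm (y v)) * norm (a z)"
    by (simp add: power2_eq_square mult_ac)
  then have "norm (a z) \<le> 2 * \<epsilon> * norm (y v)"
    using \<epsilon>(1) by (cases "norm (a z) = 0") (simp_all add: mult_le_cancel_right)
  then show ?thesis by (simp only: z(2))
qed

section \<open>Invariant projections commute\<close>

lemma projection_pythagoras:
  fixes p :: "'a::real_inner \<Rightarrow>\<^sub>L 'a"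
  assumes "\<And>u v. inner (p u) v = inner u (p v)" "\<And>v. p (p v) = p v"
  shows "inner (p u) (v - p v) = 0" "(norm v)\<^sup>2 = (norm (p v))\<^sup>2 + (norm (v - p v))\<^sup>2"
    "norm (p v) \<le> norm v" "norm (v - p v) \<le> norm v"
proof -
  show *: "inner (p u) (v - p v) = 0" for u v
    by (simp add: assms blinfun.diff_right)
  have "(norm v)\<^sup>2 = (norm (p v + (v - p v)))\<^sup>2" by simp
  also have "\<dots> = (norm (p v))\<^sup>2 + (norm (v - p v))\<^sup>2"
    by (rule norm_add_Pythagorean) (simp add: orthogonal_def *)
  finally show **: "(norm v)\<^sup>2 = (norm (p v))\<^sup>2 + (norm (v - p v))\<^sup>2" .
  show "norm (p v) \<le> norm v" "norm (v - p v) \<le> norm v"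
    by (rule power2_le_imp_le; simp add: **)+
qed

context von_neumann
begin

lemmas projD = projectionsD[OF _ bounded]

text \<open>
  \<open>F\<close> is the spectral projection of \<open>q p q\<close> at the value \<open>1/2\<close>, which is the squared cosine of the
  angle to the range of \<open>p\<close>.  It splits the range of \<open>q\<close> into directions at an angle of at most and
  of at least 45 degrees; the two parts stay orthogonal after applying \<open>p\<close> because \<open>F\<close> commutes
  with \<open>q p q\<close>.
\<close>
lemma angle_splitting:
  assumes p: "p \<in> projections M" and q: "q \<in> projections M"
  obtains F where "F \<in> projections M" "\<And>v. q (F v) = F (q v)"
    "\<And>v. q v = v \<Longrightarrow> (norm (F v))\<^sup>2 \<le> 2 * (norm (p (F v)))\<^sup>2"
    "\<And>v. q v = v \<Longrightarrow> 2 * (norm (p (v - F v)))\<^sup>2 \<le> (norm (v - F v))\<^sup>2"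
    "\<And>u v. q u = u \<Longrightarrow> q v = v \<Longrightarrow> inner (p (F u)) (p (v - F v)) = 0"
proof -
  note p = projD[OF p] and q = projD[OF q]
  \<comment> \<open>For \<open>v\<close> in the range of \<open>q\<close>, \<open>inner (k v) v\<close> is \<open>(norm (p v))\<^sup>2 - (norm v)\<^sup>2 / 2\<close>.\<close>
  define k where "k = (q o\<^sub>L (p o\<^sub>L q)) - (1/2) *\<^sub>R q"
  have k: "k v = q (p (q v)) - (1/2) *\<^sub>R q v" for v
    by (simp add: k_def blinfun.bilinear_simps)
  have kM: "k \<in> M" unfolding k_def by (intro diff_mem compose_mem scaleR_mem p q)
  then have kb: "k \<in> bounded_ops" using bounded by blast
  have "adj_op k = k"
    by (rule adj_op_eqI[OF kb]) (simp add: k inner_diff_left inner_diff_right p q)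
  moreover have "norm k \<le> 1"
  proof (rule norm_blinfun_bound)
    fix v
    have "k v = q ((1/2) *\<^sub>R (p (q v) - (q v - p (q v))))"
      by (simp add: k blinfun.bilinear_simps q algebra_simps flip: scaleR_add_left)
    also have "norm \<dots> \<le> norm ((1/2) *\<^sub>R (p (q v) - (q v - p (q v))))"
      by (rule projection_pythagoras) (use q in auto)
    also have "\<dots> \<le> (1/2) * (norm (p (q v)) + norm (q v - p (q v)))"
      using norm_triangle_ineq4[of "p (q v)" "q v - p (q v)"] by simp
    also have "\<dots> \<le> norm (q v)"
      using projection_pythagoras(3,4)[of p "q v", OF p(4,3)] by simp
    also have "\<dots> \<le> norm v" by (rule projection_pythagoras) (use q in auto)
    finally show "norm (k v) \<le> 1 * norm v" by simp
  qed simp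
  ultimately obtain F where F: "F \<in> projections M" "\<And>v. inner (k (F v)) (F v) \<ge> 0"
    "\<And>v. inner (k (v - F v)) (v - F v) \<le> 0"
    "\<And>s v. s \<in> bounded_ops \<Longrightarrow> adj_op s = s \<Longrightarrow> s o\<^sub>L k = k o\<^sub>L s \<Longrightarrow> s (F v) = F (s v)"
    using spectral_projection[OF kM] by metis
  note FF = projD[OF F(1)]
  have qF: "q (F v) = F (q v)" for v
  proof (rule F(4))
    show "adj_op q = q" using assms(2) by (simp add: projections_def)
    show "q o\<^sub>L k = k o\<^sub>L q" by (rule blinfun_eqI) (simp add: k blinfun.bilinear_simps q)
  qed (rule q)
  have kF: "k (F v) = F (k v)" for v by (rule F(4)[OF kb \<open>adj_op k = k\<close> refl])
  have form: "inner (k u) v = inner (p u) (p v) - (1/2) * inner u v" if "q u = u" "q v = v" for u v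
    using that by (simp add: k inner_diff_left q p)
  have qF1: "q (F v) = F v" if "q v = v" for v by (simp add: qF that)
  have qF2: "q (v - F v) = v - F v" if "q v = v" for v by (simp add: qF that blinfun.bilinear_simps)
  show thesis
  proof (rule that[OF F(1) qF])
    show "(norm (F v))\<^sup>2 \<le> 2 * (norm (p (F v)))\<^sup>2" if "q v = v" for v
      using F(2)[of v] unfolding form[OF qF1[OF that] qF1[OF that]] by (simp add: power2_norm_eq_inner)
    show "2 * (norm (p (v - F v)))\<^sup>2 \<le> (norm (v - F v))\<^sup>2" if "q v = v" for v
      using F(3)[of v] unfolding form[OF qF2[OF that] qF2[OF that]] by (simp add: power2_norm_eq_inner)
    show "inner (p (F u)) (p (v - F v)) = 0" if "q u = u" "q v = v" for u v
    proof -
      have *: "inner (F w) (v - F v) = 0" for w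
        by (rule projection_pythagoras) (use FF in auto)
      have "inner (k (F u)) (v - F v) = 0" unfolding kF by (rule *)
      then show ?thesis unfolding form[OF qF1[OF that(1)] qF2[OF that(2)]] using *[of u] by simp
    qed
  qed
qed

text \<open>
  On the range of \<open>p\<close> the operator \<open>y\<close> is \<open>L\<close> on the closure of the range of \<open>T\<^sup>*\<close> and \<open>1/L\<close> on
  that part of the range of \<open>p\<close> which \<open>T\<close> annihilates; it is the identity on the complement of the range of \<open>p\<close>.  The two scales are
  reciprocal, so the inverse has the same form with \<open>1/L\<close> in place of \<open>L\<close>.
\<close>
lemma two_scale_operator:
  assumes p: "p \<in> projections M" and T: "T \<in> M" "\<And>v. T (p v) = T v" and L: "L > 0"
  obtains y where "y \<in> invertible_elements M" "\<And>v. y (v - p v) = v - p v"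
    "\<And>v. p (y (p v)) = y (p v)"
    "\<And>u. T u = 0 \<Longrightarrow> y (p u) = (1 / L) *\<^sub>R p u"
    "\<And>u. (\<And>w. T w = 0 \<Longrightarrow> inner u w = 0) \<Longrightarrow> y (p u) = L *\<^sub>R p u"
proof -
  obtain g where g: "g \<in> projections M" "\<And>v. T (g v) = 0" "\<And>v. T v = 0 \<Longrightarrow> g v = v"
    using kernel_projection[OF T(1)] by metis
  note p = projD[OF p] and gg = projD[OF g(1)]
  have g1: "g v - g (p v) = v - p v" for v
    using g(3)[of "v - p v"] T(2)[of v] by (simp add: blinfun.bilinear_simps)
  have gp: "p (g v) = g (p v)" for v
  proof -
    have "inner (p (g v)) w = inner (g (p v)) w" for w
      using arg_cong[OF g1[of v], of "\<lambda>u. inner u w"] arg_cong[OF g1[of w], of "inner v"]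
      by (simp add: inner_diff_left inner_diff_right p gg)
    then show ?thesis using vector_eq_rdot by blast
  qed
  \<comment> \<open>The scale is \<open>c\<close> on the range of \<open>p - p g\<close> and \<open>1 / c\<close> on the range of \<open>p g\<close>.\<close>
  define Y where "Y c = c *\<^sub>R p + (1 / c - c) *\<^sub>R (p o\<^sub>L g) + (id_blinfun - p)" for c :: real
  have Y: "Y c v = c *\<^sub>R p v + (1 / c - c) *\<^sub>R p (g v) + (v - p v)" for c v
    by (simp add: Y_def blinfun.bilinear_simps)
  have YM: "Y c \<in> M" for c
    unfolding Y_def by (intro add_mem diff_mem scaleR_mem compose_mem id_mem p gg)
  have pY: "p (Y c v) = c *\<^sub>R p v + (1 / c - c) *\<^sub>R p (g v)" for c v
    by (simp add: Y blinfun.bilinear_simps p)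
  have pgY: "p (g (Y c v)) = (1 / c) *\<^sub>R p (g v)" for c v
    by (simp add: Y blinfun.bilinear_simps p gp gg algebra_simps)
  have inv: "Y c (Y d v) = v" if "c * d = 1" for c d v
  proof -
    have d: "d = 1 / c" "c \<noteq> 0" using that by (auto simp: eq_divide_eq mult.commute)
    have "Y c (Y d v) = c *\<^sub>R p (Y d v) + (1 / c - c) *\<^sub>R p (g (Y d v)) + (Y d v - p (Y d v))"
      by (rule Y)
    also have "Y d v - p (Y d v) = v - p v" by (simp add: pY) (simp add: Y)
    also have "c *\<^sub>R p (Y d v) + (1 / c - c) *\<^sub>R p (g (Y d v)) = p v"
      using d(2) by (simp add: pY pgY d(1) scaleR_add_right scaleR_diff_left algebra_simps)
    finally show ?thesis by simp
  qed
  show thesis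
  proof (rule that[of "Y L"])
    have "Y L o\<^sub>L Y (1/L) = id_blinfun" "Y (1/L) o\<^sub>L Y L = id_blinfun"
      using L by (auto intro!: blinfun_eqI simp: inv)
    then show "Y L \<in> invertible_elements M" using YM by (auto simp: invertible_elements_def)
    show "Y L (v - p v) = v - p v" for v
      by (simp add: Y blinfun.bilinear_simps p gp)
    show "p (Y L (p v)) = Y L (p v)" for v
      by (simp add: pY) (simp add: Y p)
    show "Y L (p u) = (1 / L) *\<^sub>R p u" if "T u = 0" for u
    proof -
      have "p (g (p u)) = p u" using g(3)[OF that] by (simp add: p flip: gp)
      then have "Y L (p u) = L *\<^sub>R p u + (1 / L - L) *\<^sub>R p u" by (simp add: Y p)
      then show ?thesis by (simp flip: scaleR_add_left)
    qed
    show "Y L (p u) = L *\<^sub>R p u" if "\<And>w. T w = 0 \<Longrightarrow> inner u w = 0" for u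
    proof -
      have "inner (g u) (g u) = 0" using that[OF g(2)[of "g u"]] by (simp add: gg)
      then have "g u = 0" by simp
      then have "p (g (p u)) = 0" by (simp add: p blinfun.bilinear_simps flip: gp)
      then show ?thesis by (simp add: Y p)
    qed
  qed
qed

end

lemma small_multiples_imp_zero:
  assumes "\<And>L::real. L \<ge> 2 \<Longrightarrow> x \<le> C / L" "0 \<le> x"
  shows "x = 0"
proof (rule ccontr)
  assume "x \<noteq> 0"
  then have x: "x > 0" using assms(2) by simp
  define L where "L = max 2 (2 * \<bar>C\<bar> / x)"
  have "x * L \<le> C" using assms(1)[of L] by (simp add: L_def field_simps)
  moreover have "x * L \<ge> 2 * \<bar>C\<bar>" "x * L \<ge> x * 2"
    using x mult_left_mono[of "2 * \<bar>C\<bar> / x" L x] mult_left_mono[of 2 L x] by (auto simp: L_def)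
  ultimately show False using x by linarith
qed

context von_neumann
begin

text \<open>
  Let \<open>w = a v\<close> be in the range of \<open>q\<close>, and let \<open>v1\<close> and \<open>v2\<close> be the parts of \<open>v\<close> at a small and at
  a large angle to the range of \<open>p\<close>.  Since \<open>y\<close> respects \<open>p\<close> and its complement, \<open>p w\<close> is nearly
  \<open>a (p v)\<close>, and this differs from \<open>a v1\<close>, which is in the range of \<open>q\<close>, by
  \<open>a (p v2) - a (v1 - p v1)\<close>.  Measured through \<open>y\<close>, both terms are of order \<open>1/L\<close> relative to
  \<open>v\<close>: the first is shrunk by \<open>y\<close>, and the second is small compared with the enlarged \<open>p v1\<close>.
  So \<open>p\<close> maps the range of \<open>q\<close> into itself.
\<close>
lemma Lat_commute:
  assumes A: "unital_subalgebra M A" "logmodular M A" and pL: "p \<in> Lat M A" and qL: "q \<in> Lat M A"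
  shows "p o\<^sub>L q = q o\<^sub>L p"
proof -
  have pP: "p \<in> projections M" and qP: "q \<in> projections M" using pL qL by (auto simp: Lat_def)
  note p = projD[OF pP] and q = projD[OF qP]
  note pyth = projection_pythagoras[of p, OF p(4,3)] and qyth = projection_pythagoras[of q, OF q(4,3)]
  obtain F where F: "F \<in> projections M" "\<And>v. q (F v) = F (q v)"
    "\<And>v. q v = v \<Longrightarrow> (norm (F v))\<^sup>2 \<le> 2 * (norm (p (F v)))\<^sup>2"
    "\<And>v. q v = v \<Longrightarrow> 2 * (norm (p (v - F v)))\<^sup>2 \<le> (norm (v - F v))\<^sup>2"
    "\<And>u v. q u = u \<Longrightarrow> q v = v \<Longrightarrow> inner (p (F u)) (p (v - F v)) = 0"
    using angle_splitting[OF pP qP] by metis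
  note FF = projD[OF F(1)]
  \<comment> \<open>Adjoint of \<open>p q F\<close>: its kernel is the orthogonal complement of the image under \<open>p\<close> of the
    directions at a small angle.\<close>
  have T: "F o\<^sub>L (q o\<^sub>L p) \<in> M" by (intro compose_mem FF p q)
  have main: "norm (p w - q (p w)) \<le> (12 * norm w) / L" if w: "q w = w" and L: "L \<ge> 2" for w L
  proof -
    obtain y where y: "y \<in> invertible_elements M" "\<And>v. y (v - p v) = v - p v"
      "\<And>v. p (y (p v)) = y (p v)"
      "\<And>u. (F o\<^sub>L (q o\<^sub>L p)) u = 0 \<Longrightarrow> y (p u) = (1 / L) *\<^sub>R p u"
      "\<And>u. (\<And>w. (F o\<^sub>L (q o\<^sub>L p)) w = 0 \<Longrightarrow> inner u w = 0) \<Longrightarrow> y (p u) = L *\<^sub>R p u"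
      using two_scale_operator[OF pP T, of L] L by (auto simp: p)
    define \<epsilon> where "\<epsilon> = 1 / L"
    have \<epsilon>: "0 < \<epsilon>" "\<epsilon> \<le> 1/2" using L by (auto simp: \<epsilon>_def field_simps)
    obtain a a' where aa: "a \<in> A" "a' \<in> A" "\<And>v. a (blinfun_apply a' v) = v"
      "\<And>v. a' (blinfun_apply a v) = v"
      and near: "\<And>u v. \<bar>inner (a u) (a v) - inner (y u) (y v)\<bar> \<le> \<epsilon> * (norm (y u) * norm (y v))"
      using logmodular_approx[OF A y(1) \<epsilon>(1)] by metis
    have near': "\<bar>(norm (a u))\<^sup>2 - (norm (y u))\<^sup>2\<bar> \<le> (1/2) * (norm (y u))\<^sup>2" for u
    proof -
      have "\<bar>(norm (a u))\<^sup>2 - (norm (y u))\<^sup>2\<bar> \<le> \<epsilon> * (norm (y u))\<^sup>2"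
        using near[of u u] by (simp add: power2_norm_eq_inner[symmetric] power2_eq_square[symmetric])
      also have "\<dots> \<le> (1/2) * (norm (y u))\<^sup>2" using \<epsilon> by (intro mult_right_mono) auto
      finally show ?thesis .
    qed
    have ay: "norm (a u) \<le> 2 * norm (y u)" for u
    proof (rule power2_le_imp_le)
      have "(norm (a u))\<^sup>2 \<le> 4 * (norm (y u))\<^sup>2"
        using near'[of u] zero_le_power2[of "norm (y u)"] by linarith
      then show "(norm (a u))\<^sup>2 \<le> (2 * norm (y u))\<^sup>2" by (simp add: power_mult_distrib)
    qed simp
    have ya: "norm (y u) \<le> 2 * norm (a u)" for u
    proof (rule power2_le_imp_le)
      have "(norm (y u))\<^sup>2 \<le> 4 * (norm (a u))\<^sup>2"
        using near'[of u] zero_le_power2[of "norm (y u)"] by linarith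
      then show "(norm (y u))\<^sup>2 \<le> (2 * norm (a u))\<^sup>2" by (simp add: power_mult_distrib)
    qed simp
    \<comment> \<open>\<open>v1\<close> and \<open>v2\<close> are the parts of \<open>v\<close> at a small and at a large angle to the range of \<open>p\<close>;
      \<open>n\<close> is the size of \<open>v\<close> as seen through \<open>y\<close>, comparable to the norm of \<open>w\<close>.\<close>
    define v where "v = a' w"
    define v1 where "v1 = F v"
    define v2 where "v2 = v - F v"
    define n where "n = norm (y v)"
    have av: "a v = w" by (simp add: v_def aa)
    have qv: "q v = v" using Lat_apply[OF qL aa(2), of w] w by (simp add: v_def)
    have qv1: "q v1 = v1" by (simp add: v1_def F qv)
    have v12: "v = v1 + v2" by (simp add: v1_def v2_def)
    have v1y: "y (p v1) = L *\<^sub>R p v1"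
    proof -
      have "y (p (p v1)) = L *\<^sub>R p (p v1)"
      proof (rule y(5))
        fix z assume "(F o\<^sub>L (q o\<^sub>L p)) z = 0"
        then have "inner v (F (q (p z))) = 0" by simp
        then show "inner (p v1) z = 0" using qv1 by (simp add: v1_def p q FF flip: F(2) q(4)) (metis F(2) FF(4) q(4) qv)
      qed
      then show ?thesis by (simp add: p)
    qed
    have v2y: "y (p v2) = (1 / L) *\<^sub>R p v2"
    proof (rule y(4))
      have "inner z ((F o\<^sub>L (q o\<^sub>L p)) v2) = 0" for z
      proof -
        have "inner z (F (q (p v2))) = inner (p (F (q z))) (p v2)"
          by (metis F(2) FF(4) p(3) p(4) q(4))
        then show ?thesis using F(5)[of "q z" v] qv q by (simp add: v2_def)
      qed
      then show "(F o\<^sub>L (q o\<^sub>L p)) v2 = 0" using inner_eq_zero_iff by blast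
    qed
    have p12: "inner (p v1) (p v2) = 0" using F(5)[OF qv qv] by (simp add: v1_def v2_def)
    have i12: "inner v1 v2 = 0"
      unfolding v1_def v2_def by (rule projection_pythagoras) (use FF in auto)
    have c12: "inner (v1 - p v1) (v2 - p v2) = 0"
      using p12 i12 p by (simp add: inner_diff_left inner_diff_right)
    have yv: "y v = (v - p v) + (L *\<^sub>R p v1 + (1 / L) *\<^sub>R p v2)"
    proof -
      have "y v = y ((v - p v) + (p v1 + p v2))" by (simp add: v12 blinfun.bilinear_simps)
      then show ?thesis by (simp only: blinfun.add_right y(2) v1y v2y)
    qed
    \<comment> \<open>The four components stay mutually orthogonal under \<open>y\<close>, which only rescales two of them.\<close>
    have n2: "n\<^sup>2 = (norm (v1 - p v1))\<^sup>2 + (norm (v2 - p v2))\<^sup>2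
        + (L * norm (p v1))\<^sup>2 + (norm (p v2) / L)\<^sup>2"
    proof -
      have "n\<^sup>2 = (norm (v - p v))\<^sup>2 + (norm (L *\<^sub>R p v1 + (1 / L) *\<^sub>R p v2))\<^sup>2"
        unfolding n_def yv
      proof (rule norm_add_Pythagorean)
        show "orthogonal (v - p v) (L *\<^sub>R p v1 + (1 / L) *\<^sub>R p v2)"
          using pyth(1)[of v1 v] pyth(1)[of v2 v]
          by (simp add: orthogonal_def inner_add_right inner_commute)
      qed
      also have "(norm (L *\<^sub>R p v1 + (1 / L) *\<^sub>R p v2))\<^sup>2 = (norm (L *\<^sub>R p v1))\<^sup>2 + (norm ((1/L) *\<^sub>R p v2))\<^sup>2"
        by (rule norm_add_Pythagorean) (simp add: orthogonal_def p12)
      also have "v - p v = (v1 - p v1) + (v2 - p v2)" by (simp add: v12 blinfun.bilinear_simps)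
      also have "(norm \<dots>)\<^sup>2 = (norm (v1 - p v1))\<^sup>2 + (norm (v2 - p v2))\<^sup>2"
        by (rule norm_add_Pythagorean) (simp add: orthogonal_def c12)
      finally show ?thesis using L by (simp add: power_divide power_mult_distrib)
    qed
    have n0: "n \<ge> 0" by (simp add: n_def)
    have b1: "norm (v1 - p v1) \<le> n / L"
    proof -
      have "norm (v1 - p v1) \<le> norm (p v1)"
      proof (rule power2_le_imp_le)
        show "(norm (v1 - p v1))\<^sup>2 \<le> (norm (p v1))\<^sup>2"
          using F(3)[OF qv] pyth(2)[of v1] by (simp add: v1_def)
      qed simp
      then have "L * norm (v1 - p v1) \<le> L * norm (p v1)" using L by (intro mult_left_mono) auto
      also have "L * norm (p v1) \<le> n"
        by (rule power2_le_imp_le[OF _ n0]) (simp add: n2)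
      finally show ?thesis using L by (simp add: pos_le_divide_eq mult.commute)
    qed
    have b2: "norm (p v2) \<le> n"
    proof (rule power2_le_imp_le[OF _ n0])
      have "(norm (p v2))\<^sup>2 \<le> (norm (v2 - p v2))\<^sup>2"
        using F(4)[OF qv] pyth(2)[of v2] by (simp add: v2_def)
      also have "\<dots> \<le> n\<^sup>2" by (simp add: n2)
      finally show "(norm (p v2))\<^sup>2 \<le> n\<^sup>2" .
    qed
    have pv: "p v - v1 = p v2 - (v1 - p v1)" by (simp add: v12 blinfun.bilinear_simps)
    have "norm (a (p v - v1)) \<le> 2 * norm (y (p v - v1))" by (rule ay)
    also have "y (p v - v1) = (1 / L) *\<^sub>R p v2 - (v1 - p v1)"
      unfolding pv by (simp only: blinfun.diff_right v2y y(2)[unfolded blinfun.diff_right])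
    also have "norm \<dots> \<le> norm ((1 / L) *\<^sub>R p v2) + norm (v1 - p v1)" by (rule norm_triangle_ineq4)
    also have "norm ((1 / L) *\<^sub>R p v2) \<le> n / L" using b2 L by (simp add: divide_right_mono)
    finally have c1: "norm (a (p v - v1)) \<le> 4 * n / L" using b1 by simp
    have "norm (p (a (v - p v))) \<le> 2 * \<epsilon> * norm (y (v - p v))"
    proof (rule near_isometry_orthogonal[where a'=a'])
      show "inner (y (v - p v)) (y (p z)) = 0" for z
        unfolding y(2) using pyth(1)[of "y (p z)" v] by (simp add: y(3) inner_commute)
      show "p (a' (p u)) = a' (p u)" for u by (rule Lat_apply[OF pL aa(2)])
    qed (use near \<epsilon> aa p in auto)
    moreover have "norm (y (v - p v)) \<le> n"
      unfolding y(2)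
    proof (rule power2_le_imp_le[OF _ n0])
      have "v - p v = (v1 - p v1) + (v2 - p v2)" by (simp add: v12 blinfun.bilinear_simps)
      then have "(norm (v - p v))\<^sup>2 = (norm (v1 - p v1))\<^sup>2 + (norm (v2 - p v2))\<^sup>2"
        using norm_add_Pythagorean[of "v1 - p v1" "v2 - p v2"] c12 by (simp add: orthogonal_def)
      then show "(norm (v - p v))\<^sup>2 \<le> n\<^sup>2" by (simp add: n2)
    qed
    then have "2 * \<epsilon> * norm (y (v - p v)) \<le> 2 * \<epsilon> * n" using \<epsilon> by (intro mult_left_mono) auto
    ultimately have c2: "norm (p (a (v - p v))) \<le> 2 * n / L" by (simp add: \<epsilon>_def)
    have qav1: "q (a v1) = a v1" using Lat_apply[OF qL aa(1), of v1] by (simp add: qv1)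
    have pap: "p (a (p v)) = a (p v)" by (rule Lat_apply[OF pL aa(1)])
    have dec: "p w - a v1 = p (a (v - p v)) + a (p v - v1)"
      by (simp add: blinfun.bilinear_simps pap av)
    have "p w - q (p w) = (p w - a v1) - q (p w - a v1)"
      by (simp add: blinfun.bilinear_simps qav1)
    also have "norm \<dots> \<le> norm (p w - a v1)" by (rule qyth)
    also have "\<dots> \<le> 2 * n / L + 4 * n / L"
      unfolding dec using norm_triangle_ineq c1 c2 by (meson add_mono order_trans)
    also have "\<dots> \<le> (12 * norm w) / L"
      using ya[of v] L by (simp add: av n_def add_divide_distrib[symmetric] divide_right_mono)
    finally show ?thesis .
  qed
  have pq: "q (p (q u)) = p (q u)" for u
  proof -
    have "norm (p (q u) - q (p (q u))) = 0"
      by (rule small_multiples_imp_zero[OF main]) (simp_all add: q)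
    then show ?thesis by simp
  qed
  show ?thesis
  proof (rule blinfun_eq_innerI)
    fix x z
    have "inner (p (q x)) z = inner (q (p (q x))) z" by (simp add: pq)
    also have "\<dots> = inner x (q (p (q z)))" by (simp add: p q)
    also have "\<dots> = inner (q (p x)) z" by (simp add: pq p q)
    finally show "inner ((p o\<^sub>L q) x) z = inner ((q o\<^sub>L p) x) z" by simp
  qed
qed

end

section \<open>Factors\<close>

lemma scaleC_zero_iff: "c *\<^sub>C (x :: 'a::complex_hilbert_space) = 0 \<longleftrightarrow> c = 0 \<or> x = 0"
  using norm_scaleC[of c x] by (metis mult_eq_0_iff norm_eq_zero)

lemma scaleC_diff_left: "(c - d) *\<^sub>C (x :: 'a::complex_hilbert_space) = c *\<^sub>C x - d *\<^sub>C x"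
  using scaleC_add_left[of "c - d" d x] by (simp add: eq_diff_eq)

lemma scaleC_one: "1 *\<^sub>C (x :: 'a::complex_hilbert_space) = x"
  using scaleR_scaleC[of 1 x] by simp

lemma cinner_scaleC_right: "cinner x (c *\<^sub>C y) = c * cinner x (y :: 'a::complex_hilbert_space)"
  using cinner_commute[of x "c *\<^sub>C y"] cinner_commute[of x y] by (simp add: cinner_scaleC_left)

text \<open>
  Written with the real inner product, the operator is visibly bounded and real-linear.
\<close>
lemma rank_one_operator:
  fixes x y :: "'a::complex_hilbert_space"
  obtains R where "R \<in> bounded_ops" "\<And>z. blinfun_apply R z = cinner x z *\<^sub>C y"
proof -
  define R where "R = Blinfun (\<lambda>z. inner x z *\<^sub>R y + inner (\<i> *\<^sub>C x) z *\<^sub>R (\<i> *\<^sub>C y))"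
  have "bounded_linear (\<lambda>z. inner x z *\<^sub>R y + inner (\<i> *\<^sub>C x) z *\<^sub>R (\<i> *\<^sub>C y))"
    by (intro bounded_linear_intros)
  then have "R z = inner x z *\<^sub>R y + inner (\<i> *\<^sub>C x) z *\<^sub>R (\<i> *\<^sub>C y)" for z
    by (simp add: R_def bounded_linear_Blinfun_apply)
  also have "\<dots> z = cinner x z *\<^sub>C y" for z
  proof -
    have "Complex a b = of_real a + of_real b * \<i>" for a b by (simp add: complex_eq_iff)
    then show ?thesis
      by (simp add: cinner_conv_inner scaleC_add_left scaleR_scaleC scaleC_scaleC)
  qed
  finally have R: "R z = cinner x z *\<^sub>C y" for z .
  then have "R \<in> bounded_ops" by (simp add: bounded_ops_def cinner_scaleC_right scaleC_scaleC)
  then show thesis using that R by blast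
qed

text \<open>
  An operator \<open>T\<close> commuting with the operator \<open>cinner x _ *\<^sub>C y\<close> sends \<open>y\<close> to a multiple of \<open>y\<close>
  whose coefficient depends on \<open>x\<close> only; fixing a nonzero \<open>x\<close> shows that \<open>T\<close> is a scalar.
\<close>
lemma factor_bounded_ops: "factor (bounded_ops :: ('a::complex_hilbert_space \<Rightarrow>\<^sub>L 'a) set)"
proof -
  have "unital_subalgebra bounded_ops (bounded_ops :: ('a \<Rightarrow>\<^sub>L 'a) set)"
    by (auto simp: unital_subalgebra_def bounded_ops_def scaleC_add_right blinfun.bilinear_simps
        scalar_op.rep_eq scaleC_scaleC mult.commute)
  moreover have "commutant (commutant bounded_ops) = (bounded_ops :: ('a \<Rightarrow>\<^sub>L 'a) set)"
    by (auto simp: commutant_def)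
  moreover have "bounded_ops \<inter> commutant bounded_ops = range (scalar_op :: complex \<Rightarrow> 'a \<Rightarrow>\<^sub>L 'a)"
  proof (intro equalityI subsetI)
    fix T :: "'a \<Rightarrow>\<^sub>L 'a" assume "T \<in> range scalar_op"
    then obtain c where T: "T = scalar_op c" by blast
    have "T \<in> bounded_ops" by (simp add: T bounded_ops_def scalar_op.rep_eq scaleC_scaleC mult.commute)
    moreover have "s o\<^sub>L T = T o\<^sub>L s" if "s \<in> bounded_ops" for s
      using that by (intro blinfun_eqI) (simp add: T bounded_ops_def scalar_op.rep_eq)
    ultimately show "T \<in> bounded_ops \<inter> commutant bounded_ops" by (simp add: commutant_def)
  next
    fix T :: "'a \<Rightarrow>\<^sub>L 'a" assume T: "T \<in> bounded_ops \<inter> commutant bounded_ops"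
    show "T \<in> range scalar_op"
    proof (cases "\<exists>x::'a. x \<noteq> 0")
      case False
      then have "T = scalar_op 0" by (intro blinfun_eqI) metis
      then show ?thesis by blast
    next
      case True
      then obtain x :: 'a where x: "x \<noteq> 0" by blast
      then have nz: "cinner x x \<noteq> 0" by (simp add: cinner_conv_inner complex_eq_iff)
      define d where "d = cinner x (T x) / cinner x x"
      have "T y = d *\<^sub>C y" for y
      proof -
        obtain R where R: "R \<in> bounded_ops" "\<And>z. blinfun_apply R z = cinner x z *\<^sub>C y"
          using rank_one_operator by blast
        have "R o\<^sub>L T = T o\<^sub>L R" using T R(1) by (simp add: commutant_def)
        then have "R (T x) = T (R x)" by (metis blinfun_apply_blinfun_compose)
        then have "cinner x (T x) *\<^sub>C y = cinner x x *\<^sub>C T y" using T by (simp add: R(2) bounded_ops_def)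
        then have "(1 / cinner x x) *\<^sub>C cinner x (T x) *\<^sub>C y = (1 / cinner x x) *\<^sub>C cinner x x *\<^sub>C T y"
          by simp
        then show ?thesis using nz by (simp add: scaleC_scaleC scaleC_one d_def)
      qed
      then have "T = scalar_op d" by (intro blinfun_eqI) (simp add: scalar_op.rep_eq)
      then show ?thesis by blast
    qed
  qed
  ultimately show ?thesis
    by (simp add: factor_def von_neumann_algebra_def adj_op_bounded)
qed

context von_neumann
begin

text \<open>
  The vectors annihilated by \<open>e M\<close> form a closed subspace invariant under both \<open>M\<close> and its
  commutant, so the projection onto it is central and hence a scalar.  It is nonzero since the
  subspace contains the range of \<open>f\<close>, and different from the identity unless \<open>e = 0\<close>.
\<close>
lemma factor_prime:
  assumes fac: "factor M" and e: "e \<in> M" and f: "f \<in> M"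
    and zero: "\<And>m v. m \<in> M \<Longrightarrow> e (m (blinfun_apply f v)) = 0"
  shows "e = 0 \<or> f = 0"
proof (rule ccontr)
  assume "\<not> (e = 0 \<or> f = 0)"
  then obtain u v where u: "blinfun_apply e u \<noteq> 0" and v: "blinfun_apply f v \<noteq> 0"
    by (metis blinfun_eqI zero_blinfun.rep_eq)
  define K where "K = {v. \<forall>m\<in>M. e (blinfun_apply m v) = 0}"
  have lin: "s (c *\<^sub>C x) = c *\<^sub>C s x" if "s \<in> M" for s c x
    using that bounded by (auto simp: bounded_ops_def)
  have sub: "subspace K" by (auto simp: K_def subspace_def blinfun.bilinear_simps)
  have "K = (\<Inter>m\<in>M. {v. e (blinfun_apply m v) = 0})" by (auto simp: K_def)
  then have clo: "closed K" by (auto intro!: closed_INT closed_Collect_eq continuous_intros)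
  have sc: "c *\<^sub>C x \<in> K" if "x \<in> K" for c x
    using that e by (simp add: K_def lin scaleC_zero_iff)
  have inv': "s x \<in> K" if s: "s \<in> commutant M" and x: "x \<in> K" for s x
  proof -
    have "e (m (s x)) = 0" if m: "m \<in> M" for m
    proof -
      have "m o\<^sub>L s = s o\<^sub>L m" "e o\<^sub>L s = s o\<^sub>L e" using s m e by (auto simp: commutant_def)
      then have "e (m (s x)) = s (e (m x))" by (metis blinfun_apply_blinfun_compose)
      then show ?thesis using x m by (simp add: K_def blinfun.bilinear_simps)
    qed
    then show ?thesis by (simp add: K_def)
  qed
  obtain c where c: "c \<in> projections M" "\<And>v. blinfun_apply c v \<in> K"
    "\<And>v. v \<in> K \<Longrightarrow> c v = v" "\<And>v w. w \<in> K \<Longrightarrow> inner (v - c v) w = 0"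
    using invariant_projection_mem[OF sub clo sc inv'] by blast
  have inv: "s x \<in> K" if s: "s \<in> M" and x: "x \<in> K" for s x
  proof -
    have "e (m (s x)) = 0" if "m \<in> M" for m
    proof -
      have "\<forall>n\<in>M. e (n x) = 0" using x by (simp add: K_def)
      then have "e ((m o\<^sub>L s) x) = 0" using compose_mem[OF that s] by blast
      then show ?thesis by simp
    qed
    then show ?thesis by (simp add: K_def)
  qed
  have "s o\<^sub>L c = c o\<^sub>L s" if s: "s \<in> M" for s
    using s bounded adj_mem[OF s] inv c by (intro projection_commutes_if_reducing[of s c K]) auto
  then have "c \<in> M \<inter> commutant M" using projD(1,2)[OF c(1)] by (simp add: commutant_def)
  then obtain t where t: "c = scalar_op t" using fac by (auto simp: factor_def)
  have "f v \<in> K" using zero by (simp add: K_def)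
  then have "t *\<^sub>C f v = 1 *\<^sub>C f v" using c(3) by (simp add: t scalar_op.rep_eq scaleC_one)
  then have "t = 1" using scaleC_diff_left[of t 1 "f v"] v by (simp add: scaleC_zero_iff)
  then have "c u = u" by (simp add: t scalar_op.rep_eq scaleC_one)
  then have "u \<in> K" using c(2)[of u] by simp
  then show False using id_mem u by (force simp: K_def)
qed

text \<open>
  Take \<open>y = 1 + m\<close> with \<open>m = e m0 f\<close>, which has inverse \<open>1 - m\<close> because \<open>f e = 0\<close>.  For \<open>w\<close> in
  the range of \<open>f\<close> both \<open>w\<close> and \<open>y w = w + m w\<close> are orthogonal to the range of \<open>p q\<close>, so \<open>a w\<close> is
  nearly orthogonal to it as well.  Being in the ranges of the commuting \<open>p\<close> and \<open>q\<close>, the vectors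
  \<open>a u\<close> and \<open>a w\<close> have an inner product seen only by the component of \<open>a w\<close> in the range of
  \<open>p q\<close>.  So it nearly vanishes, while for \<open>u = m w\<close> it is close to
  \<open>inner (y u) (y w) = (norm (m w))\<^sup>2\<close>.
\<close>
lemma commuting_Lat_corner_zero:
  assumes A: "unital_subalgebra M A" "logmodular M A" and pL: "p \<in> Lat M A" and qL: "q \<in> Lat M A"
    and comm: "p o\<^sub>L q = q o\<^sub>L p" and m0: "m0 \<in> M"
  shows "(p - (p o\<^sub>L q)) (m0 ((q - (p o\<^sub>L q)) v)) = 0"
proof -
  have pP: "p \<in> projections M" and qP: "q \<in> projections M" using pL qL by (auto simp: Lat_def)
  note p = projD[OF pP] and q = projD[OF qP]
  have pq: "q (p v) = p (q v)" for v using comm by (metis blinfun_apply_blinfun_compose)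
  have AM: "A \<subseteq> M" using A(1) by (simp add: unital_subalgebra_def)
  define r where "r = p o\<^sub>L q"
  have r: "inner (r u) v = inner u (r v)" "r (r v) = r v" "r v = p (q v)" for u v
    by (simp_all add: r_def p q pq)
  define e where "e = p - (p o\<^sub>L q)"
  define f where "f = q - (p o\<^sub>L q)"
  have e: "e v = p v - p (q v)" and f: "f v = q v - p (q v)" for v
    by (simp_all add: e_def f_def blinfun.bilinear_simps)
  define m where "m = e o\<^sub>L (m0 o\<^sub>L f)"
  have m: "m v = e (m0 (f v))" for v by (simp add: m_def)
  have z: "f (e v) = 0" "f (r v) = 0" "r (e v) = 0" "q (e v) = 0" "p (e v) = e v" "q (f v) = f v" "r (f v) = 0" "f (f v) = f v" for v
    by (simp_all add: e f r blinfun.bilinear_simps p q pq)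
  have mM: "m \<in> M" unfolding m_def e_def f_def by (intro compose_mem diff_mem p q m0)
  have mm: "m (m v) = 0" for v by (simp add: m z blinfun.bilinear_simps)
  define y where "y = id_blinfun + m"
  have y: "y v = v + m v" for v by (simp add: y_def blinfun.bilinear_simps)
  have yM: "y \<in> invertible_elements M"
  proof -
    have "y o\<^sub>L (id_blinfun - m) = id_blinfun" "(id_blinfun - m) o\<^sub>L y = id_blinfun"
      by (rule blinfun_eqI; simp add: y blinfun.bilinear_simps mm)+
    then show ?thesis using mM
      by (auto simp: invertible_elements_def y_def intro!: add_mem diff_mem id_mem exI bexI[of _ "id_blinfun - m"])
  qed
  define w where "w = f v"
  define u where "u = m w"
  have yu: "y u = u" by (simp add: y u_def mm)
  have ou: "inner u w = 0"
  proof -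
    have "inner u w = inner (e (m0 (f w))) (q w)" by (simp add: u_def m w_def z)
    also have "\<dots> = 0" by (simp add: z flip: q(4))
    finally show ?thesis .
  qed
  have bound: "(norm u)\<^sup>2 \<le> (5 * (norm u * norm (y w))) / L" if L: "L \<ge> 2" for L
  proof -
    define \<epsilon> where "\<epsilon> = 1 / L"
    have \<epsilon>: "0 < \<epsilon>" "\<epsilon> \<le> 1/2" using L by (auto simp: \<epsilon>_def field_simps)
    obtain a a' where aa: "a \<in> A" "a' \<in> A" "\<And>v. a (blinfun_apply a' v) = v"
      "\<And>v. a' (blinfun_apply a v) = v"
      and near: "\<And>u v. \<bar>inner (a u) (a v) - inner (y u) (y v)\<bar> \<le> \<epsilon> * (norm (y u) * norm (y v))"
      using logmodular_approx[OF A yM \<epsilon>(1)] by metis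
    have au: "norm (a u) \<le> 2 * norm u"
    proof (rule power2_le_imp_le)
      have "(norm (a u))\<^sup>2 - (norm u)\<^sup>2 \<le> \<epsilon> * (norm u)\<^sup>2"
        using near[of u u] by (simp add: yu power2_norm_eq_inner[symmetric] power2_eq_square[symmetric])
      also have "\<dots> \<le> 1 * (norm u)\<^sup>2" using \<epsilon> by (intro mult_right_mono) auto
      finally have "(norm (a u))\<^sup>2 \<le> 4 * (norm u)\<^sup>2"
        using zero_le_power2[of "norm u"] by linarith
      then show "(norm (a u))\<^sup>2 \<le> (2 * norm u)\<^sup>2" by (simp add: power_mult_distrib)
    qed simp
    have ra: "norm (r (a w)) \<le> 2 * \<epsilon> * norm (y w)"
    proof (rule near_isometry_orthogonal[where a'=a'])
      show "r (a' (r v)) = a' (r v)" for v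
        using Lat_apply[OF pL aa(2), of "q v"] Lat_apply[OF qL aa(2), of "p v"] by (simp add: r pq)
      have "inner (w + m w) (r z) = 0" for z
        by (simp add: w_def m z blinfun.bilinear_simps flip: r(1) add: inner_add_left)
      then show "inner (y w) (y (r z)) = 0" for z
        by (simp add: y m z blinfun.bilinear_simps)
    qed (use near \<epsilon> aa r in auto)
    have pa: "p (a u) = a u" using Lat_apply[OF pL aa(1), of u] by (simp add: u_def m z)
    have qa: "q (a w) = a w" using Lat_apply[OF qL aa(1), of w] by (simp add: w_def z)
    have "inner (y u) (y w) = (norm u)\<^sup>2"
      by (simp add: yu) (simp add: y inner_add_right ou power2_norm_eq_inner flip: u_def)
    then have "(norm u)\<^sup>2 \<le> inner (a u) (a w) + \<epsilon> * (norm u * norm (y w))"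
      using near[of u w] by (simp add: yu)
    also have "inner (a u) (a w) = inner (a u) (r (a w))"
      by (metis pa qa p(4) r(3))
    also have "\<dots> \<le> norm (a u) * norm (r (a w))" by (rule norm_cauchy_schwarz)
    also have "\<dots> \<le> (2 * norm u) * (2 * \<epsilon> * norm (y w))"
      using au ra by (intro mult_mono) auto
    finally have "(norm u)\<^sup>2 \<le> 5 * \<epsilon> * (norm u * norm (y w))" by (simp add: algebra_simps)
    then show ?thesis by (simp add: \<epsilon>_def)
  qed
  have "(norm u)\<^sup>2 = 0" by (rule small_multiples_imp_zero[OF bound]) simp_all
  then have "m w = 0" by (simp add: u_def)
  then have "e (m0 (f v)) = 0" by (simp add: w_def m z)
  then show ?thesis by (simp only: e_def f_def)
qed

lemma op_leI:
  assumes p: "p \<in> projections M" and q: "q \<in> projections M" and le: "\<And>v. q (p v) = p v"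
  shows "op_le p q"
proof -
  note p = projD[OF p] and q = projD[OF q]
  have "q - p \<in> M" using p q diff_mem by blast
  then have b: "q - p \<in> bounded_ops" using bounded by blast
  have "inner v (p v) \<le> inner v (q v)" for v
  proof -
    have pq: "p (q v) = p v"
      by (rule vector_eq_rdot[THEN iffD1]) (simp add: p q le)
    have "inner v (p v) = (norm (p (q v)))\<^sup>2" by (simp only: pq) (simp add: power2_norm_eq_inner p)
    also have "\<dots> \<le> (norm (q v))\<^sup>2"
      by (intro power_mono projection_pythagoras) (use p in auto)
    also have "\<dots> = inner v (q v)" by (simp add: power2_norm_eq_inner q)
    finally show ?thesis .
  qed
  then show ?thesis
    unfolding op_le_def using b
    by (subst positive_op_iff)
      (simp_all add: blinfun.bilinear_simps inner_diff_left inner_diff_right p q)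
qed

lemma op_le_antisym:
  assumes p: "p \<in> projections M" and q: "q \<in> projections M" and le: "op_le p q" "op_le q p"
  shows "p = q"
proof -
  note p = projD[OF p] and q = projD[OF q]
  have nn: "inner v (T v) \<ge> 0" if "positive_op T" for T :: "'a \<Rightarrow>\<^sub>L 'a" and v
    using that by (simp add: positive_op_def cinner_conv_inner complex_nonneg_Reals_iff)
  have eq: "inner v (p v) = inner v (q v)" for v
    using nn[OF le(1)[unfolded op_le_def], of v] nn[OF le(2)[unfolded op_le_def], of v]
    by (simp add: blinfun.bilinear_simps inner_diff_right)
  have "inner x (p y) = inner x (q y)" for x y
  proof -
    have "inner y (p x) = inner x (p y)" "inner y (q x) = inner x (q y)"
      using p(4)[of y x] q(4)[of y x] by (simp_all add: inner_commute)
    then show ?thesis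
      using eq[of "x + y"] eq[of x] eq[of y]
      by (simp add: blinfun.bilinear_simps inner_add_left inner_add_right)
  qed
  then show ?thesis by (intro blinfun_eq_innerI) (simp add: p q)
qed

text \<open>
  Meets and joins in the lattice of projections are specified by choice, so antisymmetry of the
  operator order is what pins them down.
\<close>
lemma comparable_meet_join:
  assumes p: "p \<in> projections M" and q: "q \<in> projections M" and le: "op_le p q"
  shows "Lattice.inf (proj_order (projections M)) {p, q} = p" "Lattice.sup (proj_order (projections M)) {p, q} = q"
proof -
  let ?L = "proj_order (projections M)"
  have refl: "op_le x x" if "x \<in> projections M" for x
    using op_leI[OF that that] projD[OF that] by simp
  have "greatest ?L x (Lower ?L {p, q}) \<longleftrightarrow> x = p" for x
    using p q le refl op_le_antisym
    by (auto simp: greatest_def Lower_def proj_order_def)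
  then show "Lattice.inf ?L {p, q} = p" by (simp add: Lattice.inf_def)
  have "least ?L x (Upper ?L {p, q}) \<longleftrightarrow> x = q" for x
    using p q le refl op_le_antisym
    by (auto simp: least_def Upper_def proj_order_def)
  then show "Lattice.sup ?L {p, q} = q" by (simp add: Lattice.sup_def)
qed

lemma Lat_nest:
  assumes fac: "factor M" and A: "unital_subalgebra M A" "logmodular M A"
  shows "nest M (Lat M A)"
proof -
  have sub: "Lat M A \<subseteq> projections M" by (auto simp: Lat_def)
  have cmp: "op_le p q \<or> op_le q p" if pL: "p \<in> Lat M A" and qL: "q \<in> Lat M A" for p q
  proof -
    have P: "p \<in> projections M" "q \<in> projections M" using that sub by auto
    note p = projD[OF P(1)] and q = projD[OF P(2)]
    have c: "p o\<^sub>L q = q o\<^sub>L p" by (rule Lat_commute[OF A pL qL])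
    have "p - (p o\<^sub>L q) = 0 \<or> q - (p o\<^sub>L q) = 0"
      by (rule factor_prime[OF fac])
        (use commuting_Lat_corner_zero[OF A pL qL c] in \<open>auto intro!: diff_mem compose_mem p q\<close>)
    then show ?thesis
    proof
      assume "p - (p o\<^sub>L q) = 0"
      then have "q o\<^sub>L p = p" using c by simp
      then have "q (p v) = p v" for v by (metis blinfun_apply_blinfun_compose)
      then show ?thesis using op_leI[OF P] by blast
    next
      assume "q - (p o\<^sub>L q) = 0"
      then have "p o\<^sub>L q = q" by simp
      then have "p (q v) = q v" for v by (metis blinfun_apply_blinfun_compose)
      then show ?thesis using op_leI[OF P(2,1)] by blast
    qed
  qed
  have "p \<sqinter>\<^bsub>proj_order (projections M)\<^esub> q \<in> Lat M A \<and> p \<squnion>\<^bsub>proj_order (projections M)\<^esub> q \<in> Lat M A"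
    if pq: "p \<in> Lat M A" "q \<in> Lat M A" for p q
  proof -
    have P: "p \<in> projections M" "q \<in> projections M" using pq sub by auto
    show ?thesis
      using cmp[OF pq]
    proof
      assume "op_le p q"
      then show ?thesis using comparable_meet_join[OF P] pq by (simp add: meet_def join_def)
    next
      assume "op_le q p"
      then show ?thesis using comparable_meet_join[OF P(2,1)] pq
        by (simp add: meet_def join_def insert_commute)
    qed
  qed
  then show ?thesis using sub cmp by (auto simp: nest_def projection_lattice_def)
qed

end

lemma reflexive_logmodular_nest:
  assumes "factor M" "unital_subalgebra M A" "reflexive_in M A" "logmodular M A"
  shows "nest_subalgebra M A"
proof -
  interpret von_neumann M using assms(1) by (simp add: von_neumann_def factor_def)
  show ?thesis
    using Lat_nest assms unfolding nest_subalgebra_def reflexive_in_def by blast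
qed

lemma Alg_reflexive:
  assumes "E \<subseteq> projections M"
  shows "reflexive_in M (Alg M E)"
  using assms unfolding reflexive_in_def Alg_def Lat_def by blast

theorem corollary2p13:
  assumes separable: "separable_space (euclidean :: 'a::complex_hilbert_space topology)"
  shows
    "(\<forall>(M :: ('a \<Rightarrow>\<^sub>L 'a) set) A.
        factor M \<and> unital_subalgebra M A \<and> closed A \<and> reflexive_in M A \<and> logmodular M A
        \<longrightarrow> nest_subalgebra M A) \<and>
     (\<forall>A :: ('a \<Rightarrow>\<^sub>L 'a) set.
        unital_subalgebra bounded_ops A \<and> reflexive_in bounded_ops A \<and> logmodular bounded_ops A
        \<longrightarrow> nest_subalgebra bounded_ops A) \<and>
     (\<forall>A :: ('a \<Rightarrow>\<^sub>L 'a) set.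
        unital_subalgebra bounded_ops A \<and> logmodular bounded_ops A \<and>
        completely_distributive_csl_algebra A
        \<longrightarrow> nest_subalgebra bounded_ops A)"
proof (intro conjI allI impI)
  show "nest_subalgebra M A"
    if "factor M \<and> unital_subalgebra M A \<and> closed A \<and> reflexive_in M A \<and> logmodular M A"
    for M A :: "('a \<Rightarrow>\<^sub>L 'a) set"
    using that reflexive_logmodular_nest by blast
  show "nest_subalgebra bounded_ops A"
    if "unital_subalgebra bounded_ops A \<and> reflexive_in bounded_ops A \<and> logmodular bounded_ops A"
    for A :: "('a \<Rightarrow>\<^sub>L 'a) set"
    using that reflexive_logmodular_nest[OF factor_bounded_ops] by blast
  fix A :: "('a \<Rightarrow>\<^sub>L 'a) set"
  assume A: "unital_subalgebra bounded_ops A \<and> logmodular bounded_ops A \<and>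
    completely_distributive_csl_algebra A"
  then have "reflexive_in bounded_ops A"
    using Alg_reflexive
    unfolding completely_distributive_csl_algebra_def csl_def projection_lattice_def by blast
  then show "nest_subalgebra bounded_ops A"
    using A reflexive_logmodular_nest[OF factor_bounded_ops] by blast
qed

end
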